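(* Let $A$ be a compact annulus (a surface diffeomorphic to $[0,1]\times S^1$) and let $x:A\to\mathbb{B}^4$ be a minimal Lagrangian immersion with Legendrian capillary boundary on $\mathbb{S}^3$. Then $\Sigma=x(A)$ is congruent to one of the Lagrangian catenoids: there exist $\lambda\in\mathbb{R}$ with $0<|\lambda|<\frac12$ and a rigid motion $P$ of $\mathbb{R}^4$ such that $x(A)=P(\Sigma_\lambda\cap\mathbb{B}^4)$.
   Context: $\mathbb{R}^4=\mathbb{C}^2$ carries its standard Euclidean inner product $\langle\cdot,\cdot\rangle$ and standard orthogonal complex structure $J$. $\mathbb{B}^4$ is the closed unit ball and $\mathbb{S}^3=\partial\mathbb{B}^4$. An immersed surface $x:\Sigma\to\mathbb{B}^4$ is Lagrangian if $J T\Sigma=T^{\bot}\Sigma$ (the normal bundle in $\mathbb{R}^4$), and minimal if its mean curvature vector vanishes. It has Legendrian boundary on $\mathbb{S}^3$ if $x(\partial\Sigma)\subset\mathbb{S}^3$ and the vector $Jx(p)$ is orthogonal to $dx(T_p\partial\Sigma)$ at each $p\in\partial\Sigma$. In that case the unit outward normal $\nu$ of $\partial\Sigma$ in $\Sigma$ (tangent to $\Sigma$) lies in $\mathrm{span}\{x,Jx\}$ and is written $\nu=\sin\theta\, x+\cos\theta\, Jx$ with contact angle $\theta:\partial\Sigma\to[0,\pi)$. The boundary is Legendrian capillary if $\theta$ is locally constant on $\partial\Sigma$ (constant on each boundary component, possibly different constants on different components). Lagrangian catenoids: for $\lambda\in\mathbb{R}\setminus\{0\}$, $$\Sigma_\lambda=\left\{\left(z,\frac{\lambda}{z}\right):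 z\in\mathbb{C}\setminus\{0\}\right\}\subset\mathbb{C}^2,$$ where $(x^1,x^2,y^1,y^2)\in\mathbb{R}^4$ is identified with $(x^1+\sqrt{-1}y^1,x^2+\sqrt{-1}y^2)\in\mathbb{C}^2$. The surface $\Sigma_\lambda$ is holomorphic for the standard complex structure, and Lagrangian with respect to the Kähler form $\mathrm{Re}(dz^1\wedge dz^2)=dx^1\wedge dx^2-dy^1\wedge dy^2$, whose associated complex structure is $(x^1,x^2,y^1,y^2)\mapsto(-x^2,x^1,y^2,-y^1)$. All orthogonal complex structures on $\mathbb{R}^4$ are conjugate under $O(4)$. "Congruent" means equal up to a rigid motion (Euclidean isometry) of $\mathbb{R}^4$. *)

theory Defs
  imports "HOL-Analysis.Analysis"
begin

section \<open>The compact annulus\<close>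

text \<open>
  A compact annulus is a set \<open>A\<close> together with a diffeomorphism
  \<open>\<phi> : [0,1] \<times> S\<^sup>1 \<rightarrow> A\<close>. The smooth structure of \<open>A\<close> is the one carried over by \<open>\<phi>\<close>, so
  that \<open>\<phi>\<close> is a diffeomorphism by construction and, at the level of sets, only has to
  be a bijection. Any smooth surface diffeomorphic to \<open>[0,1] \<times> S\<^sup>1\<close> arises in this way.
  Differential conditions on a map \<open>x\<close> defined on \<open>A\<close> are read off in the local
  coordinates \<open>(s,t) \<mapsto> \<phi> (s, exp (i t))\<close>, which range over the closed strip
  \<open>[0,1] \<times> \<real>\<close>; the boundary components of \<open>A\<close> are the curves \<open>s = 0\<close> and \<open>s = 1\<close>.
\<close>

definition compact_annulus :: "(real \<times> complex \<Rightarrow> 'a) \<Rightarrow> 'a set \<Rightarrow> bool" where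
  "compact_annulus \<phi> A \<longleftrightarrow> bij_betw \<phi> ({0..1} \<times> sphere 0 1) A"

definition in_coords :: "(real \<times> complex \<Rightarrow> 'a) \<Rightarrow> ('a \<Rightarrow> 'b) \<Rightarrow> real \<times> real \<Rightarrow> 'b" where
  "in_coords \<phi> x = (\<lambda>(s, t). x (\<phi> (s, cis t)))"

definition strip :: "(real \<times> real) set" where
  "strip = {0..1} \<times> UNIV"

definition strip_boundary :: "(real \<times> real) set" where
  "strip_boundary = {0, 1} \<times> UNIV"


section \<open>Differential calculus on the strip\<close>

text \<open>Derivatives are taken within the strip, hence one-sided across its boundary.\<close>

definition differential ::
    "(real \<times> real \<Rightarrow> 'b::real_normed_vector) \<Rightarrow> real \<times> real \<Rightarrow> real \<times> real \<Rightarrow> 'b" where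
  "differential X p = frechet_derivative X (at p within strip)"

definition partial1 :: "(real \<times> real \<Rightarrow> 'b::real_normed_vector) \<Rightarrow> real \<times> real \<Rightarrow> 'b" where
  "partial1 X p = differential X p (1, 0)"

definition partial2 :: "(real \<times> real \<Rightarrow> 'b::real_normed_vector) \<Rightarrow> real \<times> real \<Rightarrow> 'b" where
  "partial2 X p = differential X p (0, 1)"

primrec Ck_on_strip :: "nat \<Rightarrow> (real \<times> real \<Rightarrow> 'b::real_normed_vector) \<Rightarrow> bool" where
  "Ck_on_strip 0 X \<longleftrightarrow> continuous_on strip X"
| "Ck_on_strip (Suc k) X \<longleftrightarrow>
     X differentiable_on strip \<and> Ck_on_strip k (partial1 X) \<and> Ck_on_strip k (partial2 X)"

definition smooth_on_strip :: "(real \<times> real \<Rightarrow> 'b::real_normed_vector) \<Rightarrow> bool" where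
  "smooth_on_strip X \<longleftrightarrow> (\<forall>k. Ck_on_strip k X)"

text \<open>The derivative within the strip is unique, also at boundary points.\<close>

lemma differential_eqI:
  assumes "(X has_derivative D) (at p within strip)" and "p \<in> strip"
  shows "differential X p = D"
proof -
  have "(X has_derivative differential X p) (at p within strip)"
    unfolding differential_def
    using assms(1) by (meson differentiable_def frechet_derivative_works)
  then show ?thesis
  proof (rule frechet_derivative_unique_within[OF _ assms(1)])
    fix i :: "real \<times> real" and e :: real
    assume i: "i \<in> Basis" and e: "e > 0"
    define d where "d = min (e / 2) (1 / 2)"
    have d: "0 < d" "d < e" "d \<le> 1 / 2" using e by (auto simp: d_def)
    obtain s t where p: "p = (s, t)" "0 \<le> s" "s \<le> 1"
      using assms(2) by (auto simp: strip_def)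
    have "p + d *\<^sub>R i \<in> strip \<or> p + (- d) *\<^sub>R i \<in> strip"
      using i d p by (cases "s \<le> 1 / 2") (auto simp: Basis_prod_def strip_def)
    then show "\<exists>d. 0 < \<bar>d\<bar> \<and> \<bar>d\<bar> < e \<and> p + d *\<^sub>R i \<in> strip"
      using d by (metis abs_minus_cancel abs_of_pos)
  qed
qed


section \<open>Immersions and their mean curvature\<close>

definition immersion :: "(real \<times> real \<Rightarrow> 'b::real_normed_vector) \<Rightarrow> bool" where
  "immersion X \<longleftrightarrow> smooth_on_strip X \<and> (\<forall>p\<in>strip. inj (differential X p))"

definition tangent_space :: "(real \<times> real \<Rightarrow> 'b::real_normed_vector) \<Rightarrow> real \<times> real \<Rightarrow> 'b set" where
  "tangent_space X p = range (differential X p)"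

definition normal_space :: "(real \<times> real \<Rightarrow> 'b::euclidean_space) \<Rightarrow> real \<times> real \<Rightarrow> 'b set" where
  "normal_space X p = (tangent_space X p)\<^sup>\<bottom>"

text \<open>The closest point of a subspace is the orthogonal projection onto it.\<close>

definition normal_part :: "(real \<times> real \<Rightarrow> 'b::euclidean_space) \<Rightarrow> real \<times> real \<Rightarrow> 'b \<Rightarrow> 'b" where
  "normal_part X p v = closest_point (normal_space X p) v"

text \<open>
  The coefficients of the first fundamental form are \<open>E, F, G\<close>, those of the
  (normal-bundle valued) second fundamental form are the normal parts of the second
  partial derivatives. The mean curvature vector is half the metric trace of the latter,
  the inverse metric being \<open>(G, -F; -F, E) / (E G - F\<^sup>2)\<close>.
\<close>

definition mean_curvature_vector ::
    "(real \<times> real \<Rightarrow> 'b::euclidean_space) \<Rightarrow> real \<times> real \<Rightarrow> 'b" where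
  "mean_curvature_vector X p =
     (let E = partial1 X p \<bullet> partial1 X p;
          F = partial1 X p \<bullet> partial2 X p;
          G = partial2 X p \<bullet> partial2 X p;
          II11 = normal_part X p (partial1 (partial1 X) p);
          II12 = normal_part X p (partial1 (partial2 X) p);
          II22 = normal_part X p (partial2 (partial2 X) p)
      in (1 / (2 * (E * G - F\<^sup>2))) *\<^sub>R (G *\<^sub>R II11 - (2 * F) *\<^sub>R II12 + E *\<^sub>R II22))"

definition minimal :: "(real \<times> real \<Rightarrow> 'b::euclidean_space) \<Rightarrow> bool" where
  "minimal X \<longleftrightarrow> (\<forall>p\<in>strip. mean_curvature_vector X p = 0)"


section \<open>Lagrangian surfaces in the ball and Legendrian capillary boundary\<close>

text \<open>
  \<open>\<real>\<^sup>4 = \<complex>\<^sup>2\<close> is the type \<^typ>\<open>complex \<times> complex\<close>, whose inner product, norm and distance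
  are the Euclidean ones.
\<close>

definition J :: "complex \<times> complex \<Rightarrow> complex \<times> complex" where
  "J v = (\<i> * fst v, \<i> * snd v)"

definition lagrangian :: "(real \<times> real \<Rightarrow> complex \<times> complex) \<Rightarrow> bool" where
  "lagrangian X \<longleftrightarrow> (\<forall>p\<in>strip. J ` tangent_space X p = normal_space X p)"

definition legendrian_boundary :: "(real \<times> real \<Rightarrow> complex \<times> complex) \<Rightarrow> bool" where
  "legendrian_boundary X \<longleftrightarrow>
     (\<forall>p\<in>strip_boundary. X p \<in> sphere 0 1 \<and>
        (\<forall>v. fst v = 0 \<longrightarrow> orthogonal (J (X p)) (differential X p v)))"

text \<open>
  \<open>\<nu>\<close> is the unit outward normal of the boundary at \<open>p\<close>: a unit tangent vector of the
  surface, orthogonal to the boundary curve, which is the image of a coordinate vector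
  pointing out of the strip.
\<close>

definition outward_unit_normal ::
    "(real \<times> real \<Rightarrow> 'b::euclidean_space) \<Rightarrow> real \<times> real \<Rightarrow> 'b \<Rightarrow> bool" where
  "outward_unit_normal X p \<nu> \<longleftrightarrow>
     norm \<nu> = 1 \<and> (\<forall>w. fst w = 0 \<longrightarrow> orthogonal \<nu> (differential X p w)) \<and>
     (\<exists>v. \<nu> = differential X p v \<and> (if fst p = 0 then fst v < 0 else fst v > 0))"

definition contact_angle ::
    "(real \<times> real \<Rightarrow> complex \<times> complex) \<Rightarrow> (real \<times> real \<Rightarrow> real) \<Rightarrow> bool" where
  "contact_angle X \<theta> \<longleftrightarrow>
     (\<forall>p\<in>strip_boundary. \<theta> p \<in> {0..<pi} \<and>
        outward_unit_normal X p (sin (\<theta> p) *\<^sub>R X p + cos (\<theta> p) *\<^sub>R J (X p)))"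

definition legendrian_capillary_boundary :: "(real \<times> real \<Rightarrow> complex \<times> complex) \<Rightarrow> bool" where
  "legendrian_capillary_boundary X \<longleftrightarrow>
     legendrian_boundary X \<and>
     (\<exists>\<theta>. contact_angle X \<theta> \<and> \<theta> constant_on ({0} \<times> UNIV) \<and> \<theta> constant_on ({1} \<times> UNIV))"


section \<open>Lagrangian catenoids and rigid motions\<close>

definition lagrangian_catenoid :: "real \<Rightarrow> (complex \<times> complex) set" where
  "lagrangian_catenoid l = {(z, of_real l / z) | z. z \<noteq> 0}"

definition rigid_motion :: "('b::metric_space \<Rightarrow> 'b) \<Rightarrow> bool" where
  "rigid_motion P \<longleftrightarrow> (\<forall>u v. dist (P u) (P v) = dist u v) \<and> surj P"

end

theory Submission
  imports Defs "HOL-Complex_Analysis.Complex_Analysis"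
begin

text \<open>
  Minimality makes the Lagrangian angle constant, so the surface is holomorphic for a second
  orthogonal complex structure \<open>K\<close> (\<open>rotJ e\<close> below) that anticommutes with \<open>J\<close>. On a boundary
  component with constant angle \<open>\<theta>\<close> the curve is tangent to \<open>K (sin \<theta> x + cos \<theta> J x)\<close>, a linear
  vector field, hence it is a great circle; in suitable \<open>K\<close>-complex coordinates \<open>(z, w)\<close> it lies
  on \<open>z w = \<lambda>\<close> with \<open>\<lambda> = - cos \<theta> / 2\<close>. By unique continuation the whole surface lies on this curve. If
  \<open>\<lambda> \<noteq> 0\<close>, it is the part of a catenoid in the ball, since \<open>z\<close> is an open map and the part of
  the catenoid in the open ball is connected. If \<open>\<lambda> = 0\<close>, the surface is immersed in a plane with
  both boundary curves on the unit circle, and comparing the rotation numbers of the tangents of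
  the two boundary curves gives a contradiction.

  Holomorphy is expressed without isothermal coordinates: the \<open>K\<close>-holomorphic functions on the
  strip are those with \<open>\<partial>\<^sub>2 f = \<mu> \<partial>\<^sub>1 f\<close>, where \<open>\<mu>\<close> depends only on the surface and \<open>Im \<mu> > 0\<close>.
\<close>

section \<open>Partial derivatives on the strip\<close>

text \<open>A relation rather than the operators \<open>partial1\<close> and
  \<open>partial2\<close>: partial derivatives can then be supplied as explicit formulas, such as
  linear images or products, and only their values on the strip matter.\<close>

definition strip_partials ::
    "(real \<times> real \<Rightarrow> 'b::real_normed_vector) \<Rightarrow> (real \<times> real \<Rightarrow> 'b) \<Rightarrow> (real \<times> real \<Rightarrow> 'b) \<Rightarrow> bool" where
  "strip_partials f f1 f2 \<longleftrightarrow>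
     (\<forall>p\<in>strip. (f has_derivative (\<lambda>h. fst h *\<^sub>R f1 p + snd h *\<^sub>R f2 p)) (at p within strip))"

lemma strip_partialsD:
  "strip_partials f f1 f2 \<Longrightarrow> p \<in> strip \<Longrightarrow>
     (f has_derivative (\<lambda>h. fst h *\<^sub>R f1 p + snd h *\<^sub>R f2 p)) (at p within strip)"
  by (simp add: strip_partials_def)

lemma strip_partials_differential:
  "strip_partials f f1 f2 \<Longrightarrow> p \<in> strip \<Longrightarrow> differential f p h = fst h *\<^sub>R f1 p + snd h *\<^sub>R f2 p"
  by (simp add: differential_eqI[OF strip_partialsD])

lemma strip_partials_of_differentiable:
  assumes "f differentiable_on strip"
  shows "strip_partials f (partial1 f) (partial2 f)"
  unfolding strip_partials_def
proof
  fix p assume p: "p \<in> strip"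
  then have D: "(f has_derivative differential f p) (at p within strip)"
    using assms unfolding differential_def differentiable_on_def
    by (simp add: frechet_derivative_works)
  interpret bounded_linear "differential f p"
    using D by (rule has_derivative_bounded_linear)
  have "differential f p h = fst h *\<^sub>R partial1 f p + snd h *\<^sub>R partial2 f p" for h
  proof -
    have "h = fst h *\<^sub>R (1, 0) + snd h *\<^sub>R (0, 1)" by (simp add: prod_eq_iff)
    then have "differential f p h = differential f p (fst h *\<^sub>R (1, 0) + snd h *\<^sub>R (0, 1))" by simp
    then show ?thesis by (simp only: add scale partial1_def partial2_def)
  qed
  then show "(f has_derivative (\<lambda>h. fst h *\<^sub>R partial1 f p + snd h *\<^sub>R partial2 f p)) (at p within strip)"
    using D by (metis (no_types, lifting) ext)
qed

lemma Ck_on_strip_partials: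
  assumes "Ck_on_strip (Suc k) f"
  shows "strip_partials f (partial1 f) (partial2 f)"
  using assms by (simp add: strip_partials_of_differentiable)

lemma strip_partials_linear:
  assumes "bounded_linear L" "strip_partials f f1 f2"
  shows "strip_partials (\<lambda>p. L (f p)) (\<lambda>p. L (f1 p)) (\<lambda>p. L (f2 p))"
  unfolding strip_partials_def
proof
  fix p assume p: "p \<in> strip"
  interpret bounded_linear L by fact
  show "((\<lambda>p. L (f p)) has_derivative (\<lambda>h. fst h *\<^sub>R L (f1 p) + snd h *\<^sub>R L (f2 p))) (at p within strip)"
    using bounded_linear.has_derivative[OF assms(1) strip_partialsD[OF assms(2) p]]
    by (simp add: add scale)
qed

lemma strip_partials_continuous: "strip_partials f f1 f2 \<Longrightarrow> continuous_on strip f"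
  by (auto simp: continuous_on_eq_continuous_within strip_partials_def intro: has_derivative_continuous)

lemma strip_partials_vector1:
  assumes "strip_partials f f1 f2" "0 \<le> s" "s \<le> 1"
  shows "((\<lambda>s. f (s, t)) has_vector_derivative f1 (s, t)) (at s within {0..1})"
proof -
  have "((\<lambda>s. f (s, t)) has_derivative (\<lambda>h. fst (h, 0::real) *\<^sub>R f1 (s, t) + snd (h, 0::real) *\<^sub>R f2 (s, t))) (at s within {0..1})"
    by (rule has_derivative_in_compose2[of strip f "\<lambda>p h. fst h *\<^sub>R f1 p + snd h *\<^sub>R f2 p"
             "\<lambda>s. (s, t)" "{0..1}" s "\<lambda>h. (h, 0)"])
       (use assms in \<open>auto simp: strip_partials_def strip_def intro!: derivative_eq_intros\<close>)
  then show ?thesis by (simp add: has_vector_derivative_def)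
qed

lemma strip_partials_vector2:
  assumes "strip_partials f f1 f2" "0 \<le> s" "s \<le> 1"
  shows "((\<lambda>t. f (s, t)) has_vector_derivative f2 (s, t)) (at t within T)"
proof -
  have "((\<lambda>t. f (s, t)) has_derivative (\<lambda>h. fst (0::real, h) *\<^sub>R f1 (s, t) + snd (0::real, h) *\<^sub>R f2 (s, t))) (at t within UNIV)"
    by (rule has_derivative_in_compose2[of strip f "\<lambda>p h. fst h *\<^sub>R f1 p + snd h *\<^sub>R f2 p"
             "\<lambda>t. (s, t)" UNIV t "\<lambda>h. (0, h)"])
       (use assms in \<open>auto simp: strip_partials_def strip_def intro!: derivative_eq_intros\<close>)
  then show ?thesis
    by (simp add: has_vector_derivative_def has_derivative_at_withinI)
qed

text \<open>Schwarz's theorem up to the sides of the strip, where derivatives are one-sided.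
  Differentiating \<open>f (r, t) - f (0, t)\<close>, the integral of \<open>f1\<close> over
  \<open>{0..r}\<close>, in \<open>t\<close> under the integral sign shows that \<open>f12\<close>
  and \<open>f21\<close> have equal integrals over \<open>{0..r}\<close>; differentiating in
  \<open>r\<close> then gives equality.\<close>

lemma strip_partials_symmetric:
  fixes f :: "real \<times> real \<Rightarrow> 'b::euclidean_space"
  assumes f: "strip_partials f f1 f2" and f1: "strip_partials f1 f11 f12" and f2: "strip_partials f2 f21 f22"
    and c12: "continuous_on strip f12" and c21: "continuous_on strip f21"
    and p: "p \<in> strip"
  shows "f12 p = f21 p"
proof -
  obtain s t where st: "p = (s, t)" "0 \<le> s" "s \<le> 1" using p by (auto simp: strip_def)
  have cs: "continuous_on {0..r} (\<lambda>s. g (s, t))" if "continuous_on strip g" "r \<le> 1" for g :: "_ \<Rightarrow> 'b" and r t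
    by (rule continuous_on_compose2[OF that(1)]) (use that(2) in \<open>auto simp: strip_def intro!: continuous_intros\<close>)
  have eq: "integral {0..r} (\<lambda>s. f12 (s, t)) = integral {0..r} (\<lambda>s. f21 (s, t))" if r: "0 \<le> r" "r \<le> 1" for r
  proof -
    have I1: "((\<lambda>s. f1 (s, t)) has_integral f (r, t) - f (0, t)) {0..r}" for t
      by (rule fundamental_theorem_of_calculus[OF r(1)])
         (use r in \<open>auto intro: has_vector_derivative_within_subset[OF strip_partials_vector1[OF f]]\<close>)
    have I2: "((\<lambda>s. f21 (s, t)) has_integral f2 (r, t) - f2 (0, t)) {0..r}" for t
      by (rule fundamental_theorem_of_calculus[OF r(1)])
         (use r in \<open>auto intro: has_vector_derivative_within_subset[OF strip_partials_vector1[OF f2]]\<close>)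
    have "((\<lambda>t. integral (cbox 0 r) (\<lambda>s. f1 (s, t))) has_vector_derivative integral (cbox 0 r) (\<lambda>s. f12 (s, t))) (at t within UNIV)"
    proof (rule leibniz_rule_vector_derivative[where fx = "\<lambda>t s. f12 (s, t)"])
      show "((\<lambda>x. f1 (s, x)) has_vector_derivative f12 (s, t)) (at t within UNIV)" if "s \<in> cbox 0 r" for t s
        using that r strip_partials_vector2[OF f1] by auto
      show "(\<lambda>s. f1 (s, x)) integrable_on cbox 0 r" for x
        using I1 by auto
      show "continuous_on (UNIV \<times> cbox 0 r) (\<lambda>(x, s). f12 (s, x))"
        unfolding case_prod_beta
        by (rule continuous_on_compose2[OF c12]) (use r in \<open>auto simp: strip_def intro!: continuous_intros\<close>)
    qed auto
    then have "((\<lambda>t. f (r, t) - f (0, t)) has_vector_derivative integral {0..r} (\<lambda>s. f12 (s, t))) (at t)"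
      by (simp add: integral_unique[OF I1])
    moreover have "((\<lambda>t. f (r, t) - f (0, t)) has_vector_derivative f2 (r, t) - f2 (0, t)) (at t)"
      by (intro derivative_intros strip_partials_vector2[OF f]) (use r in auto)
    ultimately have "integral {0..r} (\<lambda>s. f12 (s, t)) = f2 (r, t) - f2 (0, t)"
      by (rule vector_derivative_unique_at)
    then show ?thesis by (simp add: integral_unique[OF I2])
  qed
  have "((\<lambda>r. integral {0..r} (\<lambda>s. f12 (s, t))) has_vector_derivative f12 (s, t)) (at s within {0..1})"
    by (rule integral_has_vector_derivative) (use st cs[OF c12, of 1] in auto)
  moreover have "((\<lambda>r. integral {0..r} (\<lambda>s. f21 (s, t))) has_vector_derivative f21 (s, t)) (at s within {0..1})"
    by (rule integral_has_vector_derivative) (use st cs[OF c21, of 1] in auto)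
  then have "((\<lambda>r. integral {0..r} (\<lambda>s. f12 (s, t))) has_vector_derivative f21 (s, t)) (at s within {0..1})"
    by (rule has_vector_derivative_transform[rotated 2]) (use st eq in auto)
  ultimately show ?thesis
    unfolding st
    by (rule vector_derivative_unique_within[rotated]) (use st in \<open>simp add: trivial_limit_within\<close>)
qed


section \<open>The Lagrangian angle\<close>

text \<open>The holomorphic volume form of \<open>\<complex>\<^sup>2\<close>. On a Lagrangian plane
  its argument is the Lagrangian angle.\<close>

definition cdet :: "complex \<times> complex \<Rightarrow> complex \<times> complex \<Rightarrow> complex" where
  "cdet u v = fst u * snd v - snd u * fst v"

text \<open>If \<open>a\<close> and \<open>b\<close> are derivatives of \<open>u\<close> and
  \<open>v\<close>, the left side is the derivative of the Lagrangian angle times the squared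
  modulus of \<open>cdet u v\<close>. The right side pairs them with the normals \<open>J u\<close>
  and \<open>J v\<close>, which is how the mean curvature enters.\<close>

lemma cdet_variation:
  assumes "J u \<bullet> v = 0"
  shows "Im ((cdet a v + cdet u b) * cnj (cdet u v)) =
    (v \<bullet> v) * (a \<bullet> J u) - (u \<bullet> v) * (a \<bullet> J v) - (u \<bullet> v) * (b \<bullet> J u) + (u \<bullet> u) * (b \<bullet> J v)"
proof -
  have "Im (cdet a v * cnj (cdet u v)) = (v \<bullet> v) * (a \<bullet> J u) - (u \<bullet> v) * (a \<bullet> J v) - (J u \<bullet> v) * (a \<bullet> v)"
    by (simp add: cdet_def J_def inner_prod_def inner_complex_def algebra_simps)
  moreover have "Im (cdet u b * cnj (cdet u v)) =
     (u \<bullet> u) * (b \<bullet> J v) - (u \<bullet> v) * (b \<bullet> J u) + (J u \<bullet> v) * (b \<bullet> u)"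
    by (simp add: cdet_def J_def inner_prod_def inner_complex_def algebra_simps)
  ultimately show ?thesis using assms by (simp add: algebra_simps)
qed

text \<open>The squared moduli of the Hermitian product and of the determinant add up to the product
  of the squared lengths, and \<open>J u \<bullet> v\<close> is, up to sign, the imaginary part of
  the Hermitian product.\<close>

lemma cdet_norm:
  assumes "J u \<bullet> v = 0"
  shows "(norm (cdet u v))\<^sup>2 = (u \<bullet> u) * (v \<bullet> v) - (u \<bullet> v)\<^sup>2"
proof -
  have "(norm (cdet u v))\<^sup>2 = (u \<bullet> u) * (v \<bullet> v) - (u \<bullet> v)\<^sup>2 - (J u \<bullet> v)\<^sup>2"
    unfolding cmod_power2
    by (simp add: cdet_def J_def inner_prod_def inner_complex_def algebra_simps power2_eq_square)
  then show ?thesis using assms by simp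
qed

lemma J_inner: "J u \<bullet> v = - (u \<bullet> J v)"
  by (simp add: J_def inner_prod_def inner_complex_def algebra_simps prod_eq_iff)

lemma bounded_linear_J: "bounded_linear J"
  unfolding J_def by (intro bounded_linear_intros)

lemma bounded_bilinear_cdet: "bounded_bilinear cdet"
proof -
  have 1: "bounded_bilinear (\<lambda>u v. fst u * snd v :: complex)"
    using bounded_bilinear.comp[OF bounded_bilinear_mult bounded_linear_fst bounded_linear_snd] .
  have 2: "bounded_bilinear (\<lambda>u v. snd u * fst v :: complex)"
    using bounded_bilinear.comp[OF bounded_bilinear_mult bounded_linear_snd bounded_linear_fst] .
  show ?thesis
    unfolding cdet_def
  proof
    show "\<exists>K. \<forall>a b. norm (fst a * snd b - snd a * fst b :: complex) \<le> norm a * norm b * K"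
    proof (intro exI[of _ 2] allI)
      fix a b :: "complex \<times> complex"
      have "norm (fst a * snd b - snd a * fst b) \<le> norm (fst a) * norm (snd b) + norm (snd a) * norm (fst b)"
        by (metis norm_mult norm_triangle_ineq4)
      also have "\<dots> \<le> norm a * norm b + norm a * norm b"
        using norm_fst_le[of "fst a" "snd a"] norm_fst_le[of "fst b" "snd b"]
          norm_snd_le[of "snd a" "fst a"] norm_snd_le[of "snd b" "fst b"]
        by (intro add_mono mult_mono) auto
      finally show "norm (fst a * snd b - snd a * fst b) \<le> norm a * norm b * 2" by simp
    qed
  qed (simp_all add: algebra_simps scaleR_conv_of_real)
qed

text \<open>By minimality \<open>D p / cnj (D p)\<close>, the square of the phase of the
  determinant, has zero derivative and is constant on the convex strip. This determines the phase up
  to sign, and continuity fixes the sign.\<close>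

lemma constant_lagrangian_angle:
  assumes X: "strip_partials X u v" and u: "strip_partials u a b" and v: "strip_partials v b d"
    and lag: "\<And>p. p \<in> strip \<Longrightarrow> J (u p) \<bullet> v p = 0"
    and ne: "\<And>p. p \<in> strip \<Longrightarrow> cdet (u p) (v p) \<noteq> 0"
    and H: "\<And>p n. p \<in> strip \<Longrightarrow> n \<in> {J (u p), J (v p)} \<Longrightarrow>
       (v p \<bullet> v p) * (a p \<bullet> n) - 2 * (u p \<bullet> v p) * (b p \<bullet> n) + (u p \<bullet> u p) * (d p \<bullet> n) = 0"
  shows "\<exists>e. norm e = 1 \<and> (\<forall>p\<in>strip. \<exists>q>0. cdet (u p) (v p) = of_real q * e)"
proof -
  define D where "D p = cdet (u p) (v p)" for p
  define D1 where "D1 p = cdet (a p) (v p) + cdet (u p) (b p)" for p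
  define D2 where "D2 p = cdet (b p) (v p) + cdet (u p) (d p)" for p
  interpret cdet: bounded_bilinear cdet by (rule bounded_bilinear_cdet)
  have D: "strip_partials D D1 D2"
    unfolding strip_partials_def
  proof
    fix p assume p: "p \<in> strip"
    show "(D has_derivative (\<lambda>h. fst h *\<^sub>R D1 p + snd h *\<^sub>R D2 p)) (at p within strip)"
      unfolding D_def[abs_def] D1_def D2_def
      by (rule has_derivative_eq_rhs[OF cdet.FDERIV[OF strip_partialsD[OF u p] strip_partialsD[OF v p]]])
         (auto simp: cdet.add_left cdet.add_right cdet.scaleR_left cdet.scaleR_right algebra_simps)
  qed
  \<comment> \<open>These are the symmetries of the cubic form of a Lagrangian surface, obtained by
    differentiating \<open>J u \<bullet> v = 0\<close> in both directions.\<close>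
  have lag1: "a p \<bullet> J (v p) = b p \<bullet> J (u p)" "b p \<bullet> J (v p) = d p \<bullet> J (u p)" if p: "p \<in> strip" for p
  proof -
    have z: "((\<lambda>p. J (u p) \<bullet> v p) has_derivative (\<lambda>h. 0)) (at p within strip)"
      by (rule has_derivative_transform[OF p lag has_derivative_const])
    have JJ: "((\<lambda>p. J (u p) \<bullet> v p) has_derivative
        (\<lambda>h. J (u p) \<bullet> (fst h *\<^sub>R b p + snd h *\<^sub>R d p) + J (fst h *\<^sub>R a p + snd h *\<^sub>R b p) \<bullet> v p)) (at p within strip)"
      by (intro has_derivative_inner bounded_linear.has_derivative[OF bounded_linear_J]
          strip_partialsD[OF u p] strip_partialsD[OF v p])
    have eq: "0 = J (u p) \<bullet> (fst h *\<^sub>R b p + snd h *\<^sub>R d p) + J (fst h *\<^sub>R a p + snd h *\<^sub>R b p) \<bullet> v p" for h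
      using differential_eqI[OF z p] differential_eqI[OF JJ p] by metis
    show "a p \<bullet> J (v p) = b p \<bullet> J (u p)" "b p \<bullet> J (v p) = d p \<bullet> J (u p)"
      using eq[of "(1, 0)"] eq[of "(0, 1)"]
      by (simp_all add: J_inner inner_commute[of "u p"] inner_commute[of "b p" "J (v p)"] inner_commute[of "a p" "J (v p)"])
  qed
  \<comment> \<open>With the symmetries, the two variations become the left sides of
    \<open>H\<close> for \<open>n = J u\<close> and \<open>n = J v\<close>.\<close>
  have Im0: "Im (D1 p * cnj (D p)) = 0" "Im (D2 p * cnj (D p)) = 0" if p: "p \<in> strip" for p
    unfolding D_def D1_def D2_def cdet_variation[OF lag[OF p]]
    using H[OF p, of "J (u p)"] H[OF p, of "J (v p)"] lag1[OF p] by (simp_all add: algebra_simps)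
  \<comment> \<open>Dividing by the conjugate removes the modulus of \<open>D\<close> and avoids
    choosing a branch of the argument.\<close>
  have "((\<lambda>p. D p / cnj (D p)) has_derivative (\<lambda>h. 0)) (at p within strip)" if p: "p \<in> strip" for p
  proof -
    have ne': "cnj (D p) \<noteq> 0" using ne[OF p] by (simp add: D_def)
    have "((\<lambda>p. D p / cnj (D p)) has_derivative
      (\<lambda>h. ((fst h *\<^sub>R D1 p + snd h *\<^sub>R D2 p) * cnj (D p) -
            D p * cnj (fst h *\<^sub>R D1 p + snd h *\<^sub>R D2 p)) / (cnj (D p) * cnj (D p)))) (at p within strip)"
      by (intro has_derivative_divide' ne' bounded_linear.has_derivative[OF bounded_linear_cnj]
          strip_partialsD[OF D p])
    moreover have "(fst h *\<^sub>R D1 p + snd h *\<^sub>R D2 p) * cnj (D p) -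
            D p * cnj (fst h *\<^sub>R D1 p + snd h *\<^sub>R D2 p) = 0" for h
    proof -
      have "(fst h *\<^sub>R D1 p + snd h *\<^sub>R D2 p) * cnj (D p) - D p * cnj (fst h *\<^sub>R D1 p + snd h *\<^sub>R D2 p)
        = complex_of_real (2 * (fst h * Im (D1 p * cnj (D p)) + snd h * Im (D2 p * cnj (D p)))) * \<i>"
        by (simp add: complex_eq_iff algebra_simps)
      then show ?thesis unfolding Im0[OF p] by simp
    qed
    ultimately show ?thesis by simp
  qed
  moreover have cs: "convex strip" unfolding strip_def by (intro convex_Times) auto
  ultimately have "\<exists>k. \<forall>p\<in>strip. D p / cnj (D p) = k"
    by (intro has_derivative_zero_constant)
  then obtain k where k: "\<And>p. p \<in> strip \<Longrightarrow> D p / cnj (D p) = k" by blast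
  have p0: "(0, 0) \<in> strip" by (simp add: strip_def)
  \<comment> \<open>The phase at one base point; the constant \<open>k\<close> is its
    square.\<close>
  define e where "e = sgn (D (0, 0))"
  have Dne: "D p \<noteq> 0" if "p \<in> strip" for p using ne[OF that] by (simp add: D_def)
  have e1: "norm e = 1" using Dne[OF p0] by (simp add: e_def norm_sgn)
  then have ee: "e * cnj e = 1" by (simp add: complex_norm_square[symmetric])
  have D0: "D (0, 0) = of_real (norm (D (0, 0))) * e"
    using Dne[OF p0] by (simp add: e_def sgn_eq)
  have "k = e / cnj e"
    using k[OF p0] Dne[OF p0] by (subst (asm) (1 2) D0) simp
  moreover have "cnj e \<noteq> 0" using e1 by auto
  moreover have "e * e * cnj e = e" by (simp only: mult.assoc ee mult_1_right)
  ultimately have ke: "k = e * e" by (metis nonzero_mult_div_cancel_right)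
  define r where "r p = D p * cnj e" for p
  have De: "D p = r p * e" for p unfolding r_def mult.assoc mult.commute[of "cnj e"] ee by simp
  have r_real: "Im (r p) = 0" if p: "p \<in> strip" for p
  proof -
    have "D p = e * e * cnj (D p)" using k[OF p] Dne[OF p] ke by (simp add: divide_eq_eq)
    then have "r p = (e * e * cnj (D p)) * cnj e" unfolding r_def by simp
    then have "r p = cnj (r p) * (e * cnj e)" unfolding r_def by (simp add: mult_ac)
    then have "r p = cnj (r p)" using ee by simp
    then show ?thesis by (metis complex_cnj_cancel_iff Reals_cnj_iff complex_is_Real_iff)
  qed
  \<comment> \<open>Each \<open>r p\<close> is a nonzero real, so connectedness of the strip
    propagates the positive sign from \<open>(0, 0)\<close>.\<close>
  have "continuous_on strip (\<lambda>p. Re (r p))"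
    unfolding r_def by (intro continuous_intros strip_partials_continuous[OF D])
  then have conn: "connected ((\<lambda>p. Re (r p)) ` strip)"
    by (rule connected_continuous_image) (use cs convex_connected in blast)
  have rne: "Re (r p) \<noteq> 0" if p: "p \<in> strip" for p
    using r_real[OF p] Dne[OF p] De[of p] by (metis complex_eq_iff mult_zero_left zero_complex.simps)
  have r0: "Re (r (0, 0)) > 0"
  proof -
    have "r (0, 0) = of_real (norm (D (0, 0)))"
      unfolding r_def by (subst D0) (simp add: mult.assoc ee)
    then show ?thesis using Dne[OF p0] by simp
  qed
  have "Re (r p) > 0" if p: "p \<in> strip" for p
  proof (rule ccontr)
    assume "\<not> 0 < Re (r p)"
    then have "0 \<in> {Re (r p)..Re (r (0, 0))}" using r0 by simp
    then show False
      using connected_contains_Icc[OF conn, of "Re (r p)" "Re (r (0,0))"] p p0 rne by auto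
  qed
  then have "\<forall>p\<in>strip. \<exists>q>0. D p = of_real q * e"
    using De r_real by (metis complex_eq_iff Re_complex_of_real Im_complex_of_real)
  with e1 show ?thesis unfolding D_def by blast
qed

section \<open>Unique continuation\<close>

text \<open>\<open>Im (cnj a * b)\<close> is the determinant of the real matrix with columns
  \<open>a\<close> and \<open>b\<close>; the two identities are Cramer's rule.\<close>

lemma Re_Im_solve:
  assumes "Im (cnj a * b) \<noteq> 0" "x * Re a + y * Re b = 0" "x * Im a + y * Im b = 0"
  shows "x = 0 \<and> y = (0::real)"
proof -
  have "x * Im (cnj a * b) = (x * Re a + y * Re b) * Im b - (x * Im a + y * Im b) * Re b"
       "y * Im (cnj a * b) = (x * Im a + y * Im b) * Re a - (x * Re a + y * Re b) * Im a"
    by (simp_all add: algebra_simps)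
  then show ?thesis using assms by simp
qed

text \<open>The inverse function theorem for a map given by its two complex partial derivatives. The
  last conclusion, the chain rule for \<open>\<zeta> \<circ> g\<close>, later allows the
  differential of another function to be compared with that of \<open>\<zeta>\<close>.\<close>

lemma plane_inverse_function:
  fixes \<zeta> :: "real \<times> real \<Rightarrow> complex"
  assumes U: "open U" "p0 \<in> U"
    and der: "\<And>p. p \<in> U \<Longrightarrow> (\<zeta> has_derivative (\<lambda>h. fst h *\<^sub>R a p + snd h *\<^sub>R b p)) (at p)"
    and ca: "continuous_on U a" and cb: "continuous_on U b"
    and ne: "Im (cnj (a p0) * b p0) \<noteq> 0"
  obtains U' V g g' where "open U'" "U' \<subseteq> U" "p0 \<in> U'" "open V" "homeomorphism U' V \<zeta> g"
    "\<And>y. y \<in> V \<Longrightarrow> (g has_derivative g' y) (at y)"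
    "\<And>y h. y \<in> V \<Longrightarrow> fst (g' y h) *\<^sub>R a (g y) + snd (g' y h) *\<^sub>R b (g y) = h"
proof -
  \<comment> \<open>\<open>R\<close> and \<open>C\<close> identify the complex numbers with
    \<open>real \<times> real\<close>, so that the inverse function theorem is applied to a map from
    the plane to itself.\<close>
  define R where "R c = (Re c, Im c)" for c
  define C where "C x = Complex (fst x) (snd x)" for x
  have RC [simp]: "R (C x) = x" "C (R c) = c" for x c by (simp_all add: R_def C_def)
  have blR: "bounded_linear R"
    unfolding R_def by (intro bounded_linear_Pair bounded_linear_Re bounded_linear_Im)
  have C_alt: "C = (\<lambda>x. of_real (fst x) + \<i> * of_real (snd x))" by (auto simp: C_def complex_eq_iff)
  have blC: "bounded_linear C"
    unfolding C_alt
    by (intro bounded_linear_add bounded_linear_compose[OF bounded_linear_mult_right]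
        bounded_linear_compose[OF bounded_linear_of_real] bounded_linear_fst bounded_linear_snd)
  define f where "f p = R (\<zeta> p)" for p
  define f' where "f' p = (blinfun_scaleR_left (R (a p)) o\<^sub>L Blinfun fst) + (blinfun_scaleR_left (R (b p)) o\<^sub>L Blinfun snd)" for p
  have f'_app: "blinfun_apply (f' p) h = R (fst h *\<^sub>R a p + snd h *\<^sub>R b p)" for p h
    unfolding f'_def
    by (simp add: blinfun.add_left bounded_linear_Blinfun_apply bounded_linear_fst bounded_linear_snd R_def)
  have derf: "(f has_derivative blinfun_apply (f' p)) (at p)" if "p \<in> U" for p
    unfolding f_def f'_app[abs_def] by (rule bounded_linear.has_derivative[OF blR der[OF that]])
  have contf: "continuous_on U f'"
    unfolding f'_def
    by (intro continuous_on_add bounded_bilinear.continuous_on[OF bounded_bilinear_blinfun_compose] continuous_on_const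
        bounded_linear.continuous_on[OF bounded_linear_blinfun_scaleR_left] bounded_linear.continuous_on[OF blR] ca cb)
  have "inj (blinfun_apply (f' p0))"
  proof -
    interpret f0: bounded_linear "blinfun_apply (f' p0)" by (rule blinfun.bounded_linear_right)
    show ?thesis
      unfolding linear_injective_0[OF f0.linear]
      by (auto simp: f'_app R_def prod_eq_iff dest!: Re_Im_solve[OF ne])
  qed
  then obtain h where h: "linear h" "h \<circ> blinfun_apply (f' p0) = id"
    using linear_injective_left_inverse[OF bounded_linear.linear[OF blinfun.bounded_linear_right]]
    by metis
  define invf where "invf = Blinfun h"
  have invf: "invf o\<^sub>L f' p0 = id_blinfun"
    using h by (intro blinfun_eqI)
      (auto simp: invf_def bounded_linear_Blinfun_apply linear_conv_bounded_linear fun_eq_iff)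
  obtain U' V g g' where *: "open U'" "U' \<subseteq> U" "p0 \<in> U'" "open V" "f p0 \<in> V" "homeomorphism U' V f g"
      "\<And>y. y \<in> V \<Longrightarrow> (g has_derivative (g' y)) (at y)"
    using inverse_function_theorem[OF U(1) derf contf U(2) invf] by metis
  have homRC: "homeomorphism V (C ` V) C R"
    by (intro homeomorphismI bounded_linear.continuous_on[OF blC] bounded_linear.continuous_on[OF blR])
       auto
  have C_eq: "C ` V = R -` V" by (auto simp: image_iff) (metis RC(2))
  have oCV: "open (C ` V)"
    unfolding C_eq by (rule open_vimage[OF *(4)]) (intro bounded_linear.continuous_on[OF blR] continuous_on_id)
  have hom: "homeomorphism U' (C ` V) \<zeta> (g \<circ> R)"
    using homeomorphism_compose[OF *(6) homRC] by (simp add: o_def f_def)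
  have derg: "((g \<circ> R) has_derivative (g' (R y) \<circ> R)) (at y)" if "y \<in> C ` V" for y
    using that by (intro diff_chain_at bounded_linear_imp_has_derivative[OF blR] *(7)) auto
  have "fst ((g' (R y) \<circ> R) h) *\<^sub>R a ((g \<circ> R) y) + snd ((g' (R y) \<circ> R) h) *\<^sub>R b ((g \<circ> R) y) = h"
    if y: "y \<in> C ` V" for y h
  proof -
    have gU: "(g \<circ> R) y \<in> U" using hom y *(2) unfolding homeomorphism_def by blast
    have "((\<zeta> \<circ> (g \<circ> R)) has_derivative ((\<lambda>h. fst h *\<^sub>R a ((g \<circ> R) y) + snd h *\<^sub>R b ((g \<circ> R) y)) \<circ> (g' (R y) \<circ> R))) (at y)"
      by (rule diff_chain_at[OF derg[OF y] der[OF gU]])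
    moreover have "((\<zeta> \<circ> (g \<circ> R)) has_derivative (\<lambda>h. h)) (at y)"
      by (rule has_derivative_transform_within_open[OF has_derivative_ident oCV y])
         (use hom in \<open>auto simp: homeomorphism_def\<close>)
    ultimately show ?thesis
      by (metis (no_types, lifting) has_derivative_unique comp_apply)
  qed
  then show thesis
    using that[OF *(1-3) oCV hom derg] by blast
qed

text \<open>To continue uniquely across \<open>s = 0\<close>, coordinates are extended by reflection, which keeps them
  \<open>C\<^sup>1\<close>, and the function vanishing on \<open>s = 0\<close> is extended by zero.\<close>

definition ext_odd :: "(real \<times> real \<Rightarrow> 'b::real_vector) \<Rightarrow> real \<times> real \<Rightarrow> 'b" where
  "ext_odd f p = (if fst p \<ge> 0 then f p else 2 *\<^sub>R f (0, snd p) - f (- fst p, snd p))"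

definition ext_even :: "(real \<times> real \<Rightarrow> 'b::real_vector) \<Rightarrow> real \<times> real \<Rightarrow> 'b" where
  "ext_even f p = f (\<bar>fst p\<bar>, snd p)"

text \<open>Only the side \<open>s = 0\<close> is crossed; values on \<open>s = 1\<close> are
  recovered by continuity in \<open>unique_continuation_strip\<close>.\<close>

definition wide_strip :: "(real \<times> real) set" where
  "wide_strip = {-1<..<1} \<times> UNIV"

lemma open_wide_strip: "open wide_strip"
  unfolding wide_strip_def by (intro open_Times) auto

section \<open>Gluing across the side \<open>s = 0\<close>\<close>

text \<open>Serves both the reflected coordinates and the extension by zero: agreement of values and
  of differentials along \<open>s = 0\<close> allows one-sided derivatives to be glued.\<close>

lemma has_derivative_paste:
  fixes f g :: "real \<times> real \<Rightarrow> 'b::real_normed_vector"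
  assumes f: "\<And>p. p \<in> strip \<Longrightarrow> (f has_derivative f' p) (at p within strip)"
    and g: "\<And>p. p \<in> {-1<..0} \<times> UNIV \<Longrightarrow> (g has_derivative g' p) (at p within {-1<..0} \<times> UNIV)"
    and eq: "\<And>t. f (0, t) = g (0, t)" "\<And>t. f' (0, t) = g' (0, t)"
    and p: "p \<in> wide_strip"
  shows "((\<lambda>p. if fst p \<ge> 0 then f p else g p) has_derivative (if fst p \<ge> 0 then f' p else g' p)) (at p)"
proof -
  \<comment> \<open>The pieces are disjoint, their union is the wide strip, and their closures meet
    exactly in the line \<open>s = 0\<close>.\<close>
  define S T :: "(real \<times> real) set" where "S = {0..<1} \<times> UNIV" and "T = {-1<..<0} \<times> UNIV"
  have cl: "closure S = {0..1} \<times> UNIV" "closure T = {-1..0} \<times> UNIV"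
    unfolding S_def T_def by (simp_all add: closure_Times)
  have ST: "S \<union> T = wide_strip" "S \<union> (closure S \<inter> closure T) \<subseteq> strip"
    "T \<union> (closure S \<inter> closure T) = {-1<..0} \<times> UNIV"
    unfolding cl by (auto simp: S_def T_def wide_strip_def strip_def)
  have "((\<lambda>p. if p \<in> S then f p else g p) has_derivative (if p \<in> S then f' p else g' p)) (at p within S \<union> T)"
  proof (rule has_derivative_If_within_closures)
    show "(f has_derivative f' p) (at p within S \<union> (closure S \<inter> closure T))"
      if "p \<in> S \<union> (closure S \<inter> closure T)"
      using that ST(2) by (intro has_derivative_subset[OF f]) auto
    show "(g has_derivative g' p) (at p within T \<union> (closure S \<inter> closure T))"
      if "p \<in> T \<union> (closure S \<inter> closure T)"
      using that unfolding ST(3) by (intro g)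
    show "f p = g p" "f' p = g' p" if "p \<in> closure S" "p \<in> closure T"
      using that eq unfolding cl by auto
  qed (use p ST in auto)
  then have "((\<lambda>p. if p \<in> S then f p else g p) has_derivative (if p \<in> S then f' p else g' p)) (at p)"
    unfolding ST(1) at_within_open[OF p open_wide_strip] .
  moreover have "(p \<in> S) = (fst p \<ge> 0)" if "p \<in> wide_strip" for p
    using that by (auto simp: S_def wide_strip_def)
  ultimately show ?thesis
    using p by (auto intro: has_derivative_transform_within_open[OF _ open_wide_strip p])
qed

text \<open>Reflecting \<open>f\<close> oddly about its value on \<open>s = 0\<close> reflects the
  \<open>s\<close>-derivative evenly and the \<open>t\<close>-derivative oddly again. Both stay
  continuous if they were so before, hence the extension remains \<open>C\<^sup>1\<close>.\<close>

lemma ext_odd_has_derivative: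
  assumes f: "strip_partials f f1 f2" and p: "p \<in> wide_strip"
  shows "(ext_odd f has_derivative (\<lambda>h. fst h *\<^sub>R ext_even f1 p + snd h *\<^sub>R ext_odd f2 p)) (at p)"
proof -
  have "((\<lambda>p. if fst p \<ge> 0 then f p else 2 *\<^sub>R f (0, snd p) - f (- fst p, snd p)) has_derivative
     (if fst p \<ge> 0 then (\<lambda>h. fst h *\<^sub>R f1 p + snd h *\<^sub>R f2 p)
      else (\<lambda>h. fst h *\<^sub>R f1 (- fst p, snd p) + snd h *\<^sub>R (2 *\<^sub>R f2 (0, snd p) - f2 (- fst p, snd p))))) (at p)"
  proof (rule has_derivative_paste[OF strip_partialsD[OF f] _ _ _ p])
    fix p :: "real \<times> real" assume p: "p \<in> {-1<..0} \<times> UNIV"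
    have "((\<lambda>p. f (- fst p, snd p)) has_derivative
       (\<lambda>h. fst (- fst h, snd h) *\<^sub>R f1 (- fst p, snd p) + snd (- fst h, snd h) *\<^sub>R f2 (- fst p, snd p))) (at p within {-1<..0} \<times> UNIV)"
      by (rule has_derivative_in_compose2[of strip f "\<lambda>p h. fst h *\<^sub>R f1 p + snd h *\<^sub>R f2 p"
             "\<lambda>p. (- fst p, snd p)" "{-1<..0} \<times> UNIV" p "\<lambda>h. (- fst h, snd h)"])
         (use p f in \<open>auto simp: strip_partials_def strip_def intro!: derivative_eq_intros\<close>)
    moreover have "((\<lambda>p. f (0, snd p)) has_derivative
       (\<lambda>h. fst (0::real, snd h) *\<^sub>R f1 (0, snd p) + snd (0::real, snd h) *\<^sub>R f2 (0, snd p))) (at p within {-1<..0} \<times> UNIV)"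
      by (rule has_derivative_in_compose2[of strip f "\<lambda>p h. fst h *\<^sub>R f1 p + snd h *\<^sub>R f2 p"
             "\<lambda>p. (0, snd p)" "{-1<..0} \<times> UNIV" p "\<lambda>h. (0, snd h)"])
         (use p f in \<open>auto simp: strip_partials_def strip_def intro!: derivative_eq_intros\<close>)
    ultimately show "((\<lambda>p. 2 *\<^sub>R f (0, snd p) - f (- fst p, snd p)) has_derivative
       (\<lambda>h. fst h *\<^sub>R f1 (- fst p, snd p) + snd h *\<^sub>R (2 *\<^sub>R f2 (0, snd p) - f2 (- fst p, snd p)))) (at p within {-1<..0} \<times> UNIV)"
      by (auto intro!: derivative_eq_intros simp: algebra_simps)
  qed (simp_all add: scaleR_2)
  then show ?thesis
    by (rule has_derivative_eq_rhs[OF has_derivative_transform_within_open[OF _ open_wide_strip p]])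
       (auto simp: ext_odd_def ext_even_def)
qed

lemma continuous_on_ext_even:
  assumes "continuous_on strip f"
  shows "continuous_on wide_strip (ext_even f)"
  unfolding ext_even_def
  by (rule continuous_on_compose2[OF assms])
     (auto simp: wide_strip_def strip_def intro!: continuous_intros)

lemma continuous_on_ext_odd:
  fixes f :: "real \<times> real \<Rightarrow> 'b::real_normed_vector"
  assumes "continuous_on strip f"
  shows "continuous_on wide_strip (ext_odd f)"
proof -
  have 1: "continuous_on wide_strip (\<lambda>p. f (0, snd p))"
    by (rule continuous_on_compose2[OF assms])
       (auto simp: wide_strip_def strip_def intro!: continuous_intros)
  have "continuous_on ({p. fst p \<ge> 0} \<inter> wide_strip \<union> {p. fst p \<le> 0} \<inter> wide_strip)
     (\<lambda>p. if fst p \<ge> 0 then f p else 2 *\<^sub>R f (0, snd p) - f (- fst p, snd p))"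
  proof (rule continuous_on_cases_local)
    show "continuous_on ({p. fst p \<ge> 0} \<inter> wide_strip) f"
      by (rule continuous_on_subset[OF assms]) (auto simp: wide_strip_def strip_def)
    have 2: "continuous_on ({p. fst p \<le> 0} \<inter> wide_strip) (\<lambda>p. f (- fst p, snd p))"
      by (rule continuous_on_compose2[OF assms])
         (auto simp: wide_strip_def strip_def intro!: continuous_intros)
    show "continuous_on ({p. fst p \<le> 0} \<inter> wide_strip) (\<lambda>p. 2 *\<^sub>R f (0, snd p) - f (- fst p, snd p))"
      by (intro continuous_intros 2 continuous_on_subset[OF 1]) auto
    have cls: "closed {p::real \<times> real. fst p \<ge> 0}" "closed {p::real \<times> real. fst p \<le> 0}"
      by (auto intro!: closed_Collect_le continuous_intros)
    have 3: "{p. fst p \<ge> 0} \<inter> wide_strip \<union> {p. fst p \<le> 0} \<inter> wide_strip = wide_strip" by auto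
    show "closedin (top_of_set ({p. fst p \<ge> 0} \<inter> wide_strip \<union> {p. fst p \<le> 0} \<inter> wide_strip)) ({p. fst p \<ge> 0} \<inter> wide_strip)"
      "closedin (top_of_set ({p. fst p \<ge> 0} \<inter> wide_strip \<union> {p. fst p \<le> 0} \<inter> wide_strip)) ({p. fst p \<le> 0} \<inter> wide_strip)"
      unfolding 3 using cls by (auto simp: closedin_closed)
  qed (auto simp: scaleR_2)
  moreover have "{p. fst p \<ge> 0} \<inter> wide_strip \<union> {p. fst p \<le> 0} \<inter> wide_strip = wide_strip" by auto
  ultimately show ?thesis unfolding ext_odd_def[abs_def] by simp
qed

section \<open>Functions holomorphic for the induced complex structure\<close>

text \<open>The Cauchy-Riemann equations in Beltrami form. Continuity of the partial derivatives is
  included for the inverse function theorem.\<close>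

definition holo_partials ::
    "(real \<times> real \<Rightarrow> complex) \<Rightarrow> (real \<times> real \<Rightarrow> complex) \<Rightarrow> (real \<times> real \<Rightarrow> complex) \<Rightarrow> (real \<times> real \<Rightarrow> complex) \<Rightarrow> bool" where
  "holo_partials \<mu> f f1 f2 \<longleftrightarrow> strip_partials f f1 f2 \<and> continuous_on strip f1 \<and> continuous_on strip f2 \<and>
     (\<forall>p\<in>strip. f2 p = \<mu> p * f1 p)"

lemma holo_partials_mult:
  assumes f: "holo_partials \<mu> f f1 f2" and g: "holo_partials \<mu> g g1 g2"
  shows "holo_partials \<mu> (\<lambda>p. f p * g p) (\<lambda>p. f p * g1 p + f1 p * g p) (\<lambda>p. f p * g2 p + f2 p * g p)"
  unfolding holo_partials_def
proof (intro conjI)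
  have sf: "strip_partials f f1 f2" and sg: "strip_partials g g1 g2"
    using f g by (auto simp: holo_partials_def)
  show "strip_partials (\<lambda>p. f p * g p) (\<lambda>p. f p * g1 p + f1 p * g p) (\<lambda>p. f p * g2 p + f2 p * g p)"
    unfolding strip_partials_def
    by (auto intro!: has_derivative_eq_rhs[OF has_derivative_mult[OF strip_partialsD[OF sf] strip_partialsD[OF sg]]]
        simp: algebra_simps)
  show "continuous_on strip (\<lambda>p. f p * g1 p + f1 p * g p)" "continuous_on strip (\<lambda>p. f p * g2 p + f2 p * g p)"
    using f g by (intro continuous_on_add continuous_on_mult strip_partials_continuous[OF sf]
        strip_partials_continuous[OF sg]; simp add: holo_partials_def)+
qed (use f g in \<open>auto simp: holo_partials_def algebra_simps\<close>)

lemma holo_partials_diff_const: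
  assumes "holo_partials \<mu> f f1 f2"
  shows "holo_partials \<mu> (\<lambda>p. f p - c) f1 f2"
  using assms unfolding holo_partials_def strip_partials_def
  by (auto intro!: derivative_eq_intros)

text \<open>Vanishing on \<open>s = 0\<close> kills the tangential derivative \<open>f2\<close>
  there, and as \<open>\<mu>\<close> is nonzero the equation \<open>f2 = \<mu> f1\<close> kills
  \<open>f1\<close> too. So the whole differential vanishes on that side and matches the one of the
  zero function.\<close>

lemma zero_extension_has_derivative:
  assumes f: "holo_partials \<mu> f f1 f2" and \<mu>: "\<And>p. p \<in> strip \<Longrightarrow> Im (\<mu> p) > 0"
    and f0: "\<And>t. f (0, t) = 0" and p: "p \<in> wide_strip"
  shows "((\<lambda>p. if fst p \<ge> 0 then f p else 0) has_derivative
     (if fst p \<ge> 0 then (\<lambda>h. fst h *\<^sub>R f1 p + snd h *\<^sub>R f2 p) else (\<lambda>h. 0))) (at p)"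
proof (rule has_derivative_paste[OF _ has_derivative_const _ _ p])
  have sf: "strip_partials f f1 f2" using f by (simp add: holo_partials_def)
  show "(f has_derivative (\<lambda>h. fst h *\<^sub>R f1 p + snd h *\<^sub>R f2 p)) (at p within strip)" if "p \<in> strip" for p
    by (rule strip_partialsD[OF sf that])
  show "f (0, t) = 0" for t by (rule f0)
  fix t
  have st: "(0, t) \<in> strip" by (simp add: strip_def)
  have "((\<lambda>t. f (0, t)) has_vector_derivative f2 (0, t)) (at t)"
    by (rule strip_partials_vector2[OF sf]) auto
  moreover have "((\<lambda>t. f (0, t)) has_vector_derivative 0) (at t)"
    using f0 by simp
  ultimately have "f2 (0, t) = 0" by (rule vector_derivative_unique_at)
  moreover from this have "f1 (0, t) = 0"
    using f \<mu>[OF st] st by (auto simp: holo_partials_def)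
  ultimately show "(\<lambda>h. fst h *\<^sub>R f1 (0, t) + snd h *\<^sub>R f2 (0, t)) = (\<lambda>h. 0)"
    by simp
qed

text \<open>Where \<open>a p0\<close> is nonzero, the reflected \<open>\<zeta>\<close> is a local
  coordinate. In it \<open>F\<close> is holomorphic, by the common equation for
  \<open>s \<ge> 0\<close> and because \<open>F\<close> is zero for \<open>s < 0\<close>, so the
  identity theorem for holomorphic functions applies.\<close>

lemma local_unique_continuation:
  assumes \<mu>: "\<And>p. p \<in> strip \<Longrightarrow> Im (\<mu> p) > 0"
    and \<zeta>: "holo_partials \<mu> \<zeta> a b" and f: "holo_partials \<mu> f f1 f2"
    and f0: "\<And>t. f (0, t) = 0"
    and p0: "p0 \<in> wide_strip" "fst p0 \<ge> 0" "a p0 \<noteq> 0"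
  defines "F \<equiv> (\<lambda>p. if fst p \<ge> 0 then f p else 0)"
  shows "\<exists>N. open N \<and> p0 \<in> N \<and> N \<subseteq> wide_strip \<and>
     (\<forall>W. open W \<longrightarrow> W \<noteq> {} \<longrightarrow> W \<subseteq> N \<longrightarrow> (\<forall>p\<in>W. F p = 0) \<longrightarrow> (\<forall>p\<in>N. F p = 0))"
proof -
  have in_strip: "p \<in> strip" if "p \<in> wide_strip" "fst p \<ge> 0" for p
    using that by (auto simp: wide_strip_def strip_def)
  have s\<zeta>: "strip_partials \<zeta> a b" using \<zeta> by (simp add: holo_partials_def)
  have ext0: "ext_even a p = a p" "ext_odd b p = b p" if "fst p \<ge> 0" for p
    using that by (auto simp: ext_even_def ext_odd_def abs_of_nonneg)
  have "b p0 = \<mu> p0 * a p0" using \<zeta> in_strip p0 by (auto simp: holo_partials_def)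
  \<comment> \<open>The Jacobian of \<open>\<zeta>\<close> is \<open>Im \<mu>\<close> times the
    squared modulus of \<open>a\<close>, hence nonzero at \<open>p0\<close>.\<close>
  then have "Im (cnj (a p0) * b p0) = Im (\<mu> p0) * (norm (a p0))\<^sup>2"
    unfolding cmod_power2 by (simp add: power2_eq_square algebra_simps)
  then have ne: "Im (cnj (ext_even a p0) * ext_odd b p0) \<noteq> 0"
    using \<mu>[OF in_strip[OF p0(1,2)]] p0(3) ext0[OF p0(2)] by simp
  obtain U' V g g' where UV: "open U'" "U' \<subseteq> wide_strip" "p0 \<in> U'" "open V"
    and hom: "homeomorphism U' V (ext_odd \<zeta>) g"
    and g': "\<And>y. y \<in> V \<Longrightarrow> (g has_derivative g' y) (at y)"
      "\<And>y h. y \<in> V \<Longrightarrow> fst (g' y h) *\<^sub>R ext_even a (g y) + snd (g' y h) *\<^sub>R ext_odd b (g y) = h"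
    using plane_inverse_function[OF open_wide_strip p0(1) ext_odd_has_derivative[OF s\<zeta>] _ _ ne]
      continuous_on_ext_even[of a] continuous_on_ext_odd[of b] \<zeta>
    unfolding holo_partials_def by metis
  have gV: "g y \<in> U'" "ext_odd \<zeta> (g y) = y" if "y \<in> V" for y
    using hom that unfolding homeomorphism_def by auto
  have gU: "ext_odd \<zeta> p \<in> V" "g (ext_odd \<zeta> p) = p" if "p \<in> U'" for p
    using hom that unfolding homeomorphism_def by auto
  have hol: "(F \<circ> g) holomorphic_on V"
    unfolding holomorphic_on_open[OF UV(4)]
  proof
    fix y assume y: "y \<in> V"
    have gw: "g y \<in> wide_strip" using gV y UV(2) by blast
    have D: "((F \<circ> g) has_derivative
      ((if fst (g y) \<ge> 0 then (\<lambda>h. fst h *\<^sub>R f1 (g y) + snd h *\<^sub>R f2 (g y)) else (\<lambda>h. 0)) \<circ> g' y)) (at y)"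
      unfolding F_def
      by (rule diff_chain_at[OF g'(1)[OF y] zero_extension_has_derivative[OF f \<mu> f0 gw]])
    show "\<exists>d. ((F \<circ> g) has_field_derivative d) (at y)"
    proof (cases "fst (g y) \<ge> 0")
      case True
      note st = in_strip[OF gw True]
      have ba: "b (g y) = \<mu> (g y) * a (g y)" "f2 (g y) = \<mu> (g y) * f1 (g y)"
        using \<zeta> f st by (auto simp: holo_partials_def)
      have g'2: "(of_real (fst (g' y h)) + of_real (snd (g' y h)) * \<mu> (g y)) * a (g y) = h" for h
        using g'(2)[OF y, of h] by (simp add: ext0[OF True] ba scaleR_conv_of_real algebra_simps)
      have ane: "a (g y) \<noteq> 0" using g'2[of 1] by auto
      \<comment> \<open>Since \<open>f\<close> and \<open>\<zeta>\<close> satisfy the same equation,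
        the differential of \<open>f\<close> is \<open>f1 / a\<close> times that of
        \<open>\<zeta>\<close>, hence complex linear in the coordinate.\<close>
      have "fst (g' y h) *\<^sub>R f1 (g y) + snd (g' y h) *\<^sub>R f2 (g y) = f1 (g y) / a (g y) * h" for h
      proof -
        have "fst (g' y h) *\<^sub>R f1 (g y) + snd (g' y h) *\<^sub>R f2 (g y)
          = (of_real (fst (g' y h)) + of_real (snd (g' y h)) * \<mu> (g y)) * f1 (g y)"
          by (simp add: ba scaleR_conv_of_real algebra_simps)
        also have "(of_real (fst (g' y h)) + of_real (snd (g' y h)) * \<mu> (g y)) = h / a (g y)"
          using g'2[of h] ane by (metis nonzero_mult_div_cancel_right)
        finally show ?thesis by simp
      qed
      then have "((F \<circ> g) has_derivative (\<lambda>h. f1 (g y) / a (g y) * h)) (at y)"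
        using D True by (simp add: o_def)
      then show ?thesis unfolding has_field_derivative_def by blast
    next
      case False
      then have "((F \<circ> g) has_derivative (\<lambda>h. 0)) (at y)" using D by (simp add: o_def)
      then show ?thesis unfolding has_field_derivative_def by (intro exI[of _ 0]) (simp add: lambda_zero[symmetric])
    qed
  qed
  obtain r where r: "r > 0" "ball (ext_odd \<zeta> p0) r \<subseteq> V"
    using UV(4) gU(1)[OF UV(3)] open_contains_ball by blast
  \<comment> \<open>A ball is connected, as the identity theorem requires of the coordinate
    domain.\<close>
  define B where "B = ball (ext_odd \<zeta> p0) r"
  define N where "N = U' \<inter> ext_odd \<zeta> -` B"
  have oN: "open N"
    unfolding N_def B_def using hom UV(1)
    by (intro continuous_open_preimage) (auto simp: homeomorphism_def)
  have "\<forall>p\<in>N. F p = 0" if W: "open W" "W \<noteq> {}" "W \<subseteq> N" "\<forall>p\<in>W. F p = 0" for W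
  proof
    fix p assume p: "p \<in> N"
    have oVW: "open (B \<inter> g -` W)"
    proof (rule continuous_open_preimage[OF _ _ W(1)])
      show "continuous_on B g"
        using hom r(2) unfolding homeomorphism_def B_def by (blast intro: continuous_on_subset)
    qed (simp add: B_def)
    have "(F \<circ> g) (ext_odd \<zeta> p) = 0"
    proof (rule analytic_continuation_open[OF oVW _ _ _ _ holomorphic_on_subset[OF hol] holomorphic_on_const])
      obtain w where "w \<in> W" using W(2) by blast
      then have "ext_odd \<zeta> w \<in> B \<inter> g -` W" using W(3) gU[of w] by (auto simp: N_def)
      then show "B \<inter> g -` W \<noteq> {}" by blast
      show "ext_odd \<zeta> p \<in> B" using p by (simp add: N_def)
    qed (use W r in \<open>auto simp: B_def\<close>)
    then show "F p = 0" using p gU by (simp add: N_def)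
  qed
  moreover have "p0 \<in> N" using UV(3) r(1) by (simp add: N_def B_def)
  moreover have "N \<subseteq> wide_strip" using UV(2) by (auto simp: N_def)
  ultimately show ?thesis using oN by blast
qed

text \<open>Open-closed argument for the set \<open>Z\<close> of points near which the extension by
  zero vanishes. At every point of the strip one of \<open>z\<close>, \<open>w\<close> is a local
  coordinate by \<open>imm\<close>, and the added region \<open>s < 0\<close> supplies points to
  start from.\<close>

theorem unique_continuation_strip:
  assumes \<mu>: "\<And>p. p \<in> strip \<Longrightarrow> Im (\<mu> p) > 0"
    and z: "holo_partials \<mu> z z1 z2" and w: "holo_partials \<mu> w w1 w2"
    and imm: "\<And>p. p \<in> strip \<Longrightarrow> z1 p \<noteq> 0 \<or> w1 p \<noteq> 0"
    and f: "holo_partials \<mu> f f1 f2" and f0: "\<And>t. f (0, t) = 0"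
    and p: "p \<in> strip"
  shows "f p = 0"
proof -
  define F where "F = (\<lambda>p. if fst p \<ge> 0 then f p else 0)"
  define Z where "Z = {p \<in> wide_strip. \<exists>N. open N \<and> p \<in> N \<and> (\<forall>q\<in>N. F q = 0)}"
  have local: "\<exists>N. open N \<and> p0 \<in> N \<and> N \<subseteq> wide_strip \<and>
     (\<forall>W. open W \<longrightarrow> W \<noteq> {} \<longrightarrow> W \<subseteq> N \<longrightarrow> (\<forall>p\<in>W. F p = 0) \<longrightarrow> (\<forall>p\<in>N. F p = 0))"
    if "p0 \<in> wide_strip" "fst p0 \<ge> 0" for p0
  proof -
    have "p0 \<in> strip" using that by (auto simp: wide_strip_def strip_def)
    then show ?thesis
      using imm local_unique_continuation[OF \<mu> z f f0 that] local_unique_continuation[OF \<mu> w f f0 that]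
      unfolding F_def by blast
  qed
  have neg: "p \<in> Z" if "p \<in> wide_strip" "fst p < 0" for p
    unfolding Z_def
    using that by (auto simp: F_def intro!: exI[of _ "{p. fst p < (0::real)}"] open_Collect_less continuous_intros)
  have oZ: "open Z"
    unfolding open_subopen[of Z]
  proof
    fix p assume "p \<in> Z"
    then obtain N where "p \<in> wide_strip" "open N" "p \<in> N" "\<forall>q\<in>N. F q = 0" by (auto simp: Z_def)
    then show "\<exists>T. open T \<and> p \<in> T \<and> T \<subseteq> Z"
      by (intro exI[of _ "N \<inter> wide_strip"]) (auto simp: Z_def open_wide_strip)
  qed
  have oC: "open (wide_strip - Z)"
    unfolding open_subopen[of "wide_strip - Z"]
  proof
    fix p assume p: "p \<in> wide_strip - Z"
    then have "fst p \<ge> 0" using neg[of p] by (cases "fst p < 0") auto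
    then obtain N where N: "open N" "p \<in> N" "N \<subseteq> wide_strip"
      "\<And>W. open W \<Longrightarrow> W \<noteq> {} \<Longrightarrow> W \<subseteq> N \<Longrightarrow> (\<forall>p\<in>W. F p = 0) \<Longrightarrow> (\<forall>p\<in>N. F p = 0)"
      using local[of p] p by blast
    \<comment> \<open>If \<open>N\<close> met \<open>Z\<close>, then \<open>F\<close> would vanish
      on a nonempty open part of \<open>N\<close>, hence on all of \<open>N\<close>, which would put
      \<open>p\<close> into \<open>Z\<close>.\<close>
    have "N \<inter> Z = {}"
    proof (rule ccontr)
      assume "N \<inter> Z \<noteq> {}"
      then obtain q M where "q \<in> N" "open M" "q \<in> M" "\<forall>q\<in>M. F q = 0" by (auto simp: Z_def)
      then have "\<forall>p\<in>N. F p = 0" using N(1) by (intro N(4)[of "N \<inter> M"]) auto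
      then show False using p N(1,2) by (auto simp: Z_def)
    qed
    then show "\<exists>T. open T \<and> p \<in> T \<and> T \<subseteq> wide_strip - Z" using N by blast
  qed
  have "connected wide_strip"
    unfolding wide_strip_def by (intro convex_connected convex_Times) auto
  moreover have "(- 1 / 2, 0) \<in> Z" by (rule neg) (auto simp: wide_strip_def)
  moreover have "Z \<subseteq> wide_strip" by (auto simp: Z_def)
  ultimately have Z: "Z = wide_strip"
    using connectedD[of wide_strip Z "wide_strip - Z"] oZ oC by blast
  have zero: "f (s, t) = 0" if "0 \<le> s" "s < 1" for s t
  proof -
    have "(s, t) \<in> Z" unfolding Z using that by (auto simp: wide_strip_def)
    then show ?thesis using that by (force simp: Z_def F_def)
  qed
  obtain s t where p: "p = (s, t)" "0 \<le> s" "s \<le> 1" using p by (auto simp: strip_def)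
  show ?thesis
  proof (cases "s < 1")
    case True then show ?thesis using zero p by simp
  next
    case False
    then have s1: "s = 1" using p by simp
    \<comment> \<open>The side \<open>s = 1\<close> lies outside \<open>wide_strip\<close>; values
      there are limits from the left.\<close>
    have "continuous_on strip f"
      using f by (auto simp: holo_partials_def intro: strip_partials_continuous)
    then have "continuous_on {0..1} (\<lambda>s. f (s, t))"
      by (rule continuous_on_compose2) (auto simp: strip_def intro!: continuous_intros)
    then have "((\<lambda>s. f (s, t)) \<longlongrightarrow> f (1, t)) (at 1 within {0..1})"
      by (simp add: continuous_on_def)
    then have "((\<lambda>s. f (s, t)) \<longlongrightarrow> f (1, t)) (at_left 1)"
      by (simp add: at_within_Icc_at_left)
    moreover have "((\<lambda>s. f (s, t)) \<longlongrightarrow> 0) (at_left 1)"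
      by (rule tendsto_eventually) (auto simp: eventually_at_left_field zero intro!: exI[of _ 0])
    ultimately have "f (1, t) = 0" by (rule tendsto_unique[rotated]) auto
    then show ?thesis using p s1 by simp
  qed
qed

section \<open>Minimal Lagrangian surfaces are holomorphic for a rotated complex structure\<close>

text \<open>For \<open>norm e = 1\<close> this is orthogonal, squares to minus the identity and
  anticommutes with \<open>J\<close>, so the two generate a quaternionic structure. The Lagrangian
  planes on which \<open>cdet\<close> has phase \<open>e\<close> are its complex lines.\<close>

definition rotJ :: "complex \<Rightarrow> complex \<times> complex \<Rightarrow> complex \<times> complex" where
  "rotJ e u = (- e * cnj (snd u), e * cnj (fst u))"

lemma rotJ_linear: "rotJ e (x *\<^sub>R u + y *\<^sub>R v) = x *\<^sub>R rotJ e u + y *\<^sub>R rotJ e v"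
  by (simp add: rotJ_def algebra_simps)

text \<open>Invariance of the tangent plane under \<open>rotJ e\<close>, in the basis
  \<open>u\<close>, \<open>v\<close>. Replacing \<open>of_real q * e\<close> by
  \<open>cdet u v\<close> leaves only Hermitian products, and that of \<open>u\<close> and
  \<open>v\<close> is real because the plane is Lagrangian.\<close>

lemma rotJ_tangent:
  assumes lag: "J u \<bullet> v = 0" and D: "cdet u v = of_real q * e"
  shows "q *\<^sub>R rotJ e u = (u \<bullet> u) *\<^sub>R v - (u \<bullet> v) *\<^sub>R u"
    and "q *\<^sub>R rotJ e v = (u \<bullet> v) *\<^sub>R v - (v \<bullet> v) *\<^sub>R u"
proof -
  have F: "of_real (u \<bullet> v) = fst v * cnj (fst u) + snd v * cnj (snd u)"
          "of_real (u \<bullet> v) = fst u * cnj (fst v) + snd u * cnj (snd v)"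
    using lag by (auto simp: J_def inner_prod_def inner_complex_def complex_eq_iff algebra_simps)
  have N: "of_real (u \<bullet> u) = fst u * cnj (fst u) + snd u * cnj (snd u)" for u :: "complex \<times> complex"
    by (simp add: inner_prod_def inner_complex_def complex_eq_iff algebra_simps)
  have "q *\<^sub>R rotJ e u = (- cdet u v * cnj (snd u), cdet u v * cnj (fst u))"
    unfolding D rotJ_def by (simp add: scaleR_conv_of_real mult.assoc)
  also have "\<dots> = (u \<bullet> u) *\<^sub>R v - (u \<bullet> v) *\<^sub>R u"
    by (simp add: prod_eq_iff scaleR_conv_of_real F(1) N cdet_def algebra_simps)
  finally show "q *\<^sub>R rotJ e u = (u \<bullet> u) *\<^sub>R v - (u \<bullet> v) *\<^sub>R u" .
  have "q *\<^sub>R rotJ e v = (- cdet u v * cnj (snd v), cdet u v * cnj (fst v))"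
    unfolding D rotJ_def by (simp add: scaleR_conv_of_real mult.assoc)
  also have "\<dots> = (u \<bullet> v) *\<^sub>R v - (v \<bullet> v) *\<^sub>R u"
    by (simp add: prod_eq_iff scaleR_conv_of_real F(2) N cdet_def algebra_simps)
  finally show "q *\<^sub>R rotJ e v = (u \<bullet> v) *\<^sub>R v - (v \<bullet> v) *\<^sub>R u" .
qed

text \<open>\<open>rotJ e\<close> turns the tangent plane by a right angle, so it sends the conormal
  \<open>n\<close> to a multiple of \<open>v\<close>. The factor is explicit because its sign, that
  of \<open>x\<close>, gives the direction in which the boundary is traversed.\<close>

lemma rotJ_conormal:
  assumes lag: "J u \<bullet> v = 0" and D: "cdet u v = of_real q * e" and e: "norm e = 1" and q: "q > 0"
    and n: "n = x *\<^sub>R u + y *\<^sub>R v" "n \<bullet> v = 0" and x: "x \<noteq> 0"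
  shows "v = ((v \<bullet> v) / (x * q)) *\<^sub>R rotJ e n"
proof -
  have q2: "q\<^sup>2 = (u \<bullet> u) * (v \<bullet> v) - (u \<bullet> v)\<^sup>2"
    using cdet_norm[OF lag] D e q by (simp add: norm_mult power_mult_distrib)
  have xy: "x * (u \<bullet> v) + y * (v \<bullet> v) = 0"
    using n by (simp add: inner_add_left)
  have "q *\<^sub>R rotJ e n = x *\<^sub>R (q *\<^sub>R rotJ e u) + y *\<^sub>R (q *\<^sub>R rotJ e v)"
    unfolding n(1) rotJ_linear by (simp add: algebra_simps)
  also have "\<dots> = (x * (u \<bullet> u) + y * (u \<bullet> v)) *\<^sub>R v - (x * (u \<bullet> v) + y * (v \<bullet> v)) *\<^sub>R u"
    unfolding rotJ_tangent[OF lag D] by (simp add: algebra_simps)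
  finally have 1: "q *\<^sub>R rotJ e n = (x * (u \<bullet> u) + y * (u \<bullet> v)) *\<^sub>R v" unfolding xy by simp
  have "(v \<bullet> v) * (x * (u \<bullet> u) + y * (u \<bullet> v)) = x * q\<^sup>2 + (u \<bullet> v) * (x * (u \<bullet> v) + y * (v \<bullet> v))"
    unfolding q2 by (simp add: algebra_simps power2_eq_square)
  then have 2: "(v \<bullet> v) * (x * (u \<bullet> u) + y * (u \<bullet> v)) = x * q\<^sup>2" unfolding xy by simp
  have "((v \<bullet> v) / (x * q)) *\<^sub>R rotJ e n = ((v \<bullet> v) / (x * q\<^sup>2)) *\<^sub>R (q *\<^sub>R rotJ e n)"
    using q by (simp add: power2_eq_square)
  also have "\<dots> = (((v \<bullet> v) * (x * (u \<bullet> u) + y * (u \<bullet> v))) / (x * q\<^sup>2)) *\<^sub>R v"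
    unfolding 1 by simp
  also have "\<dots> = v" unfolding 2 using x q by simp
  finally show ?thesis by simp
qed

section \<open>From the geometric hypotheses to first and second derivatives\<close>

text \<open>The variational inequality for the closest point, tested at \<open>c + n\<close> and at
  \<open>c - n\<close> in the subspace, becomes an equality.\<close>

lemma normal_part_inner:
  assumes "n \<in> normal_space X p"
  shows "normal_part X p w \<bullet> n = w \<bullet> n"
proof -
  define N where "N = normal_space X p"
  define c where "c = closest_point N w"
  have sub: "subspace N" unfolding N_def normal_space_def by (rule subspace_orthogonal_comp)
  have N: "convex N" "closed N" "N \<noteq> {}"
    using sub subspace_imp_convex closed_subspace subspace_0 by auto
  have c: "c \<in> N" unfolding c_def using N by (intro closest_point_in_set)
  have n: "n \<in> N" using assms by (simp add: N_def)
  have "(w - c) \<bullet> ((c + n) - c) \<le> 0" "(w - c) \<bullet> ((c - n) - c) \<le> 0"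
    unfolding c_def
    using closest_point_dot[OF N(1,2), of _ w] subspace_add[OF sub c n] subspace_diff[OF sub c n]
    unfolding c_def by blast+
  then show ?thesis
    by (simp add: normal_part_def N_def[symmetric] c_def[symmetric] inner_diff_left)
qed

text \<open>Gathers what the later argument uses of the three hypotheses. \<open>b\<close> is both
  mixed second derivatives, and \<open>e\<close> is the constant phase of the determinant.\<close>

lemma minimal_lagrangian_data:
  assumes imm: "immersion X" and min: "minimal X" and lag: "lagrangian X"
  obtains u v a b d e q where
    "strip_partials X u v" "strip_partials u a b" "strip_partials v b d"
    "continuous_on strip b" "continuous_on strip d" "norm e = 1"
    "\<And>p. p \<in> strip \<Longrightarrow> J (u p) \<bullet> v p = 0"
    "\<And>p. p \<in> strip \<Longrightarrow> u p \<noteq> 0"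
    "\<And>p. p \<in> strip \<Longrightarrow> v p \<noteq> 0"
    "\<And>p. p \<in> strip \<Longrightarrow> q p > 0"
    "\<And>p. p \<in> strip \<Longrightarrow> cdet (u p) (v p) = of_real (q p) * e"
proof -
  define u where "u = partial1 X"
  define v where "v = partial2 X"
  define a where "a = partial1 u"
  define b where "b = partial1 v"
  define d where "d = partial2 v"
  have Ck: "Ck_on_strip k X" for k using imm by (simp add: immersion_def smooth_on_strip_def)
  have Ck1: "Ck_on_strip k u" "Ck_on_strip k v" for k
    using Ck[of "Suc k"] by (simp_all add: u_def v_def)
  have Ck2: "Ck_on_strip k (partial2 u)" "Ck_on_strip k b" "Ck_on_strip k d" for k
    using Ck1[of "Suc k"] by (simp_all add: b_def d_def)
  have X: "strip_partials X u v" unfolding u_def v_def by (rule Ck_on_strip_partials[OF Ck])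
  have u': "strip_partials u a (partial2 u)" unfolding a_def by (rule Ck_on_strip_partials[OF Ck1(1)])
  have v: "strip_partials v b d" unfolding b_def d_def by (rule Ck_on_strip_partials[OF Ck1(2)])
  have cont: "continuous_on strip (partial2 u)" "continuous_on strip b" "continuous_on strip d"
    using Ck2[of 0] by simp_all
  have "partial2 u p = b p" if "p \<in> strip" for p
    by (rule strip_partials_symmetric[OF X u' v cont(1,2) that])
  then have u: "strip_partials u a b" using u' by (simp add: strip_partials_def)
  have tu: "u p \<in> tangent_space X p" "v p \<in> tangent_space X p" for p
    by (auto simp: tangent_space_def u_def v_def partial1_def partial2_def)
  have Jn: "J (u p) \<in> normal_space X p" "J (v p) \<in> normal_space X p" if "p \<in> strip" for p
    using lag tu that unfolding lagrangian_def by blast+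
  have lag0: "J (u p) \<bullet> v p = 0" if p: "p \<in> strip" for p
    using Jn(1)[OF p] tu(2)[of p]
    by (auto simp: normal_space_def orthogonal_comp_def orthogonal_def inner_commute)
  have inj: "x = 0 \<and> y = 0" if p: "p \<in> strip" and xy: "x *\<^sub>R u p + y *\<^sub>R v p = 0" for x y p
  proof -
    have "differential X p (x, y) = differential X p (0, 0)"
      using xy by (simp add: strip_partials_differential[OF X p])
    then show ?thesis using imm p by (auto simp: immersion_def inj_def)
  qed
  have u0: "u p \<noteq> 0" and v0: "v p \<noteq> 0" if p: "p \<in> strip" for p
    using inj[OF p, of 1 0] inj[OF p, of 0 1] by auto
  have gram: "(u p \<bullet> u p) * (v p \<bullet> v p) - (u p \<bullet> v p)\<^sup>2 \<noteq> 0" if p: "p \<in> strip" for p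
  proof
    assume 0: "(u p \<bullet> u p) * (v p \<bullet> v p) - (u p \<bullet> v p)\<^sup>2 = 0"
    \<comment> \<open>A multiple of the component of \<open>v p\<close> orthogonal to
      \<open>u p\<close>; its squared length is \<open>u p \<bullet> u p\<close> times the Gram
      determinant.\<close>
    define y where "y = (- (u p \<bullet> v p)) *\<^sub>R u p + (u p \<bullet> u p) *\<^sub>R v p"
    have "y \<bullet> y = (u p \<bullet> u p) * ((u p \<bullet> u p) * (v p \<bullet> v p) - (u p \<bullet> v p)\<^sup>2)"
      unfolding y_def
      by (simp add: inner_add_left inner_add_right inner_diff_left inner_diff_right algebra_simps power2_eq_square inner_commute)
    then have "y = 0" unfolding 0 by simp
    then have "u p \<bullet> u p = 0" using inj[OF p, of "- (u p \<bullet> v p)" "u p \<bullet> u p"] by (simp add: y_def)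
    then show False using u0[OF p] by simp
  qed
  have D0: "cdet (u p) (v p) \<noteq> 0" if p: "p \<in> strip" for p
    using cdet_norm[OF lag0[OF p]] gram[OF p] by auto
  have H: "(v p \<bullet> v p) * (a p \<bullet> n) - 2 * (u p \<bullet> v p) * (b p \<bullet> n) + (u p \<bullet> u p) * (d p \<bullet> n) = 0"
    if p: "p \<in> strip" and n: "n \<in> {J (u p), J (v p)}" for p n
  proof -
    have nN: "n \<in> normal_space X p" using Jn[OF p] n by auto
    \<comment> \<open>The equation is cleared of its nonzero denominator and paired with the normal
      \<open>n\<close>, which turns normal parts into the second derivatives themselves.\<close>
    have "mean_curvature_vector X p = 0" using min p by (simp add: minimal_def)
    then have "(v p \<bullet> v p) *\<^sub>R normal_part X p (a p) - (2 * (u p \<bullet> v p)) *\<^sub>R normal_part X p (b p)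
       + (u p \<bullet> u p) *\<^sub>R normal_part X p (d p) = 0"
      using gram[OF p]
      by (simp add: mean_curvature_vector_def Let_def u_def[symmetric] v_def[symmetric]
          a_def[symmetric] b_def[symmetric] d_def[symmetric])
    then have "((v p \<bullet> v p) *\<^sub>R normal_part X p (a p) - (2 * (u p \<bullet> v p)) *\<^sub>R normal_part X p (b p)
       + (u p \<bullet> u p) *\<^sub>R normal_part X p (d p)) \<bullet> n = 0" by simp
    then show ?thesis
      by (simp add: inner_add_left inner_diff_left normal_part_inner[OF nN])
  qed
  obtain e where e: "norm e = 1" "\<forall>p\<in>strip. \<exists>q>0. cdet (u p) (v p) = of_real q * e"
    using constant_lagrangian_angle[OF X u v lag0 D0 H] by blast
  then obtain q where "\<forall>p\<in>strip. q p > 0 \<and> cdet (u p) (v p) = of_real (q p) * e"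
    by metis
  then show thesis
    using that[OF X u v cont(2,3) e(1) lag0 u0 v0, of q] by blast
qed


section \<open>Adapted coordinates\<close>

text \<open>For \<open>e\<close> and \<open>(\<alpha>, \<beta>)\<close> of norm one,
  \<open>P\<close> and \<open>R\<close> are the unitary coordinates of \<open>x\<close> in the basis
  \<open>(\<alpha>, \<beta>)\<close>, \<open>rotJ e (\<alpha>, \<beta>)\<close>. Their real and
  imaginary parts are regrouped into coordinates complex linear for \<open>rotJ e\<close>; the sign
  of \<open>Im R\<close> reflects that \<open>rotJ e\<close> and \<open>J\<close>
  anticommute.\<close>

definition adapted :: "complex \<Rightarrow> complex \<Rightarrow> complex \<Rightarrow> complex \<times> complex \<Rightarrow> complex \<times> complex" where
  "adapted e \<alpha> \<beta> x =
     (let P = fst x * cnj \<alpha> + snd x * cnj \<beta>; R = cnj e * (snd x * \<alpha> - fst x * \<beta>)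
      in (Complex (Re P) (Re R), Complex (Im P) (- Im R)))"

lemma bounded_linear_adapted: "bounded_linear (adapted e \<alpha> \<beta>)"
proof -
  have "linear (adapted e \<alpha> \<beta>)"
    by (rule linearI) (auto simp: adapted_def Let_def complex_eq_iff algebra_simps)
  then show ?thesis by (simp add: linear_conv_bounded_linear)
qed

text \<open>\<open>J\<close> becomes antilinear in these coordinates: the standard quaternionic
  structure.\<close>

lemma adapted_J:
  "fst (adapted e \<alpha> \<beta> (J x)) = - cnj (snd (adapted e \<alpha> \<beta> x))"
  "snd (adapted e \<alpha> \<beta> (J x)) = cnj (fst (adapted e \<alpha> \<beta> x))"
  by (simp_all add: adapted_def J_def Let_def complex_eq_iff algebra_simps)

lemma adapted_rotJ:
  assumes "norm e = 1"
  shows "fst (adapted e \<alpha> \<beta> (rotJ e x)) = \<i> * fst (adapted e \<alpha> \<beta> x)"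
    "snd (adapted e \<alpha> \<beta> (rotJ e x)) = \<i> * snd (adapted e \<alpha> \<beta> x)"
proof -
  have ee: "cnj e * e = 1" using assms by (metis complex_norm_square mult.commute one_power2 of_real_1)
  define P R where "P = fst x * cnj \<alpha> + snd x * cnj \<beta>" and "R = cnj e * (snd x * \<alpha> - fst x * \<beta>)"
  have 1: "fst (rotJ e x) * cnj \<alpha> + snd (rotJ e x) * cnj \<beta> = - cnj R"
    by (simp add: rotJ_def R_def algebra_simps)
  have "cnj e * (snd (rotJ e x) * \<alpha> - fst (rotJ e x) * \<beta>) = (cnj e * e) * cnj P"
    unfolding rotJ_def P_def by (simp add: algebra_simps)
  then have 2: "cnj e * (snd (rotJ e x) * \<alpha> - fst (rotJ e x) * \<beta>) = cnj P"
    unfolding ee by simp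
  show "fst (adapted e \<alpha> \<beta> (rotJ e x)) = \<i> * fst (adapted e \<alpha> \<beta> x)"
    "snd (adapted e \<alpha> \<beta> (rotJ e x)) = \<i> * snd (adapted e \<alpha> \<beta> x)"
    unfolding adapted_def Let_def 1 2 P_def[symmetric] R_def[symmetric]
    by (simp_all add: complex_eq_iff)
qed

lemma adapted_norm:
  assumes "norm e = 1" "(norm \<alpha>)\<^sup>2 + (norm \<beta>)\<^sup>2 = 1"
  shows "norm (adapted e \<alpha> \<beta> x) = norm x"
proof -
  define P R where "P = fst x * cnj \<alpha> + snd x * cnj \<beta>" and "R = snd x * \<alpha> - fst x * \<beta>"
  have "(norm (adapted e \<alpha> \<beta> x))\<^sup>2 = (norm P)\<^sup>2 + (norm (cnj e * R))\<^sup>2"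
    unfolding adapted_def Let_def P_def[symmetric] R_def[symmetric] norm_prod_def
    by (simp only: real_sqrt_pow2 sum_power2_ge_zero add_nonneg_nonneg zero_le_power2 cmod_power2 fst_conv snd_conv)
       (simp add: cmod_power2 power2_eq_square algebra_simps)
  also have "\<dots> = (norm P)\<^sup>2 + (norm R)\<^sup>2" using assms(1) by (simp add: norm_mult)
  also have "\<dots> = ((norm (fst x))\<^sup>2 + (norm (snd x))\<^sup>2) * ((norm \<alpha>)\<^sup>2 + (norm \<beta>)\<^sup>2)"
    unfolding P_def R_def cmod_power2 by (simp add: power2_eq_square algebra_simps)
  also have "\<dots> = (norm x)\<^sup>2" using assms(2) by (simp add: norm_prod_def)
  finally show ?thesis by simp
qed

text \<open>By \<open>rotJ_conormal\<close> the boundary velocity \<open>v p\<close> is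
  \<open>r\<close> times the image of the unit normal under \<open>rotJ e\<close>. On
  \<open>s = 0\<close> the outward direction has negative \<open>s\<close>-component, whence the two
  signs of \<open>r\<close>.\<close>

lemma adapted_boundary:
  fixes \<alpha> \<beta> :: complex
  assumes X: "strip_partials X u v" and p: "p \<in> strip"
    and lag: "J (u p) \<bullet> v p = 0" and D: "cdet (u p) (v p) = of_real q * e" and e: "norm e = 1" and q: "q > 0"
    and v0: "v p \<noteq> 0"
    and n: "outward_unit_normal X p (\<sigma> *\<^sub>R X p + \<gamma> *\<^sub>R J (X p))"
  defines "z \<equiv> fst (adapted e \<alpha> \<beta> (X p))" and "w \<equiv> snd (adapted e \<alpha> \<beta> (X p))"
  shows "\<exists>r. (if fst p = 0 then r < 0 else r > 0) \<and>
     fst (adapted e \<alpha> \<beta> (v p)) = \<i> * of_real r * (of_real \<sigma> * z - of_real \<gamma> * cnj w) \<and>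
     snd (adapted e \<alpha> \<beta> (v p)) = \<i> * of_real r * (of_real \<sigma> * w + of_real \<gamma> * cnj z)"
proof -
  define m where "m = \<sigma> *\<^sub>R X p + \<gamma> *\<^sub>R J (X p)"
  obtain h where h: "m = differential X p h" "if fst p = 0 then fst h < 0 else fst h > 0"
    using n unfolding outward_unit_normal_def m_def by blast
  have m: "m = fst h *\<^sub>R u p + snd h *\<^sub>R v p"
    unfolding h(1) by (rule strip_partials_differential[OF X p])
  have "orthogonal m (differential X p (0, 1))"
    using n unfolding outward_unit_normal_def m_def by auto
  then have mv: "m \<bullet> v p = 0"
    by (simp add: strip_partials_differential[OF X p] orthogonal_def)
  have h0: "fst h \<noteq> 0" using h(2) by (auto split: if_splits)
  define r where "r = (v p \<bullet> v p) / (fst h * q)"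
  have v: "v p = r *\<^sub>R rotJ e m"
    unfolding r_def by (rule rotJ_conormal[OF lag D e q m mv h0])
  interpret A: bounded_linear "adapted e \<alpha> \<beta>" by (rule bounded_linear_adapted)
  have Am: "fst (adapted e \<alpha> \<beta> m) = of_real \<sigma> * z - of_real \<gamma> * cnj w"
    "snd (adapted e \<alpha> \<beta> m) = of_real \<sigma> * w + of_real \<gamma> * cnj z"
    unfolding m_def A.add A.scale by (simp_all add: adapted_J z_def w_def scaleR_conv_of_real)
  have "v p \<bullet> v p > 0" using v0 by simp
  then have "if fst p = 0 then r < 0 else r > 0"
    using h(2) q by (auto simp: r_def divide_neg_neg divide_pos_neg mult_neg_pos split: if_splits)
  moreover have "adapted e \<alpha> \<beta> (v p) = r *\<^sub>R adapted e \<alpha> \<beta> (rotJ e m)"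
    by (subst v) (rule A.scale)
  ultimately show ?thesis
    by (intro exI[of _ r]) (simp add: adapted_rotJ[OF e] Am scaleR_conv_of_real)
qed

text \<open>The coordinates are fitted to the boundary curve \<open>s = 0\<close>: the last
  conclusion places its base point in a real plane that is invariant under the linear vector field
  to which the curve is tangent.\<close>

lemma adapted_coordinates:
  assumes imm: "immersion X" and min: "minimal X" and lag: "lagrangian X"
    and cap: "legendrian_capillary_boundary X"
  obtains e \<alpha> \<beta> \<mu> z z1 z2 w w1 w2 z21 z22 \<sigma>\<^sub>0 \<gamma>\<^sub>0 \<sigma>\<^sub>1 \<gamma>\<^sub>1 where
    "norm e = 1" "(norm \<alpha>)\<^sup>2 + (norm \<beta>)\<^sup>2 = 1"
    "\<And>p. adapted e \<alpha> \<beta> (X p) = (z p, w p)"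
    "\<And>p. p \<in> strip \<Longrightarrow> Im (\<mu> p) > 0"
    "holo_partials \<mu> z z1 z2" "holo_partials \<mu> w w1 w2"
    "\<And>p. p \<in> strip \<Longrightarrow> z1 p \<noteq> 0 \<or> w1 p \<noteq> 0"
    "strip_partials z2 z21 z22" "continuous_on strip z22"
    "\<sigma>\<^sub>0 \<ge> 0" "\<sigma>\<^sub>0\<^sup>2 + \<gamma>\<^sub>0\<^sup>2 = 1" "\<sigma>\<^sub>1 \<ge> 0" "\<sigma>\<^sub>1\<^sup>2 + \<gamma>\<^sub>1\<^sup>2 = 1"
    "\<And>t. \<exists>r<0. z2 (0, t) = \<i> * of_real r * (of_real \<sigma>\<^sub>0 * z (0, t) - of_real \<gamma>\<^sub>0 * cnj (w (0, t))) \<and>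
                w2 (0, t) = \<i> * of_real r * (of_real \<sigma>\<^sub>0 * w (0, t) + of_real \<gamma>\<^sub>0 * cnj (z (0, t)))"
    "\<And>t. \<exists>r>0. z2 (1, t) = \<i> * of_real r * (of_real \<sigma>\<^sub>1 * z (1, t) - of_real \<gamma>\<^sub>1 * cnj (w (1, t))) \<and>
                w2 (1, t) = \<i> * of_real r * (of_real \<sigma>\<^sub>1 * w (1, t) + of_real \<gamma>\<^sub>1 * cnj (z (1, t)))"
    "\<And>p. p \<in> strip_boundary \<Longrightarrow> norm (X p) = 1"
    "of_real (1 + \<sigma>\<^sub>0) * w (0, 0) + of_real \<gamma>\<^sub>0 * cnj (z (0, 0)) = 0"
proof -
  obtain u v a b d e q where X: "strip_partials X u v" and u: "strip_partials u a b" and v: "strip_partials v b d"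
    and cont: "continuous_on strip b" "continuous_on strip d" and e: "norm e = 1"
    and lag0: "\<And>p. p \<in> strip \<Longrightarrow> J (u p) \<bullet> v p = 0"
    and u0: "\<And>p. p \<in> strip \<Longrightarrow> u p \<noteq> 0"
    and v0: "\<And>p. p \<in> strip \<Longrightarrow> v p \<noteq> 0"
    and q: "\<And>p. p \<in> strip \<Longrightarrow> q p > 0"
    and D: "\<And>p. p \<in> strip \<Longrightarrow> cdet (u p) (v p) = of_real (q p) * e"
    by (rule minimal_lagrangian_data[OF imm min lag]) (rule that; assumption)
  obtain \<theta> where \<theta>: "contact_angle X \<theta>" "\<theta> constant_on ({0} \<times> UNIV)" "\<theta> constant_on ({1} \<times> UNIV)"
    and leg: "legendrian_boundary X"
    using cap unfolding legendrian_capillary_boundary_def by blast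
  obtain \<theta>0 where \<theta>0: "\<theta> (0, t) = \<theta>0" for t using \<theta>(2) by (auto simp: constant_on_def)
  obtain \<theta>1 where \<theta>1: "\<theta> (1, t) = \<theta>1" for t using \<theta>(3) by (auto simp: constant_on_def)
  have bd: "(0, t) \<in> strip_boundary" "(1, t) \<in> strip_boundary" for t by (auto simp: strip_boundary_def)
  have st: "(0, t) \<in> strip" "(1, t) \<in> strip" for t by (auto simp: strip_def)
  have n0: "outward_unit_normal X (0, t) (sin \<theta>0 *\<^sub>R X (0, t) + cos \<theta>0 *\<^sub>R J (X (0, t)))" for t
    using \<theta>(1) bd[of t] unfolding contact_angle_def \<theta>0[of t, symmetric] by blast
  have n1: "outward_unit_normal X (1, t) (sin \<theta>1 *\<^sub>R X (1, t) + cos \<theta>1 *\<^sub>R J (X (1, t)))" for t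
    using \<theta>(1) bd[of t] unfolding contact_angle_def \<theta>1[of t, symmetric] by blast
  have "\<theta>0 \<in> {0..<pi}" "\<theta>1 \<in> {0..<pi}"
    using \<theta>(1) bd \<theta>0[of 0] \<theta>1[of 0] unfolding contact_angle_def by metis+
  then have s: "sin \<theta>0 \<ge> 0" "sin \<theta>1 \<ge> 0" by (auto intro: sin_ge_zero)
  have sph: "norm (X p) = 1" if "p \<in> strip_boundary" for p
    using leg that by (auto simp: legendrian_boundary_def)

  define \<sigma> \<gamma> where "\<sigma> = sin \<theta>0" and "\<gamma> = cos \<theta>0"
  have \<sigma>: "\<sigma> \<ge> 0" "\<sigma>\<^sup>2 + \<gamma>\<^sup>2 = 1" using s by (simp_all add: \<sigma>_def \<gamma>_def)
  \<comment> \<open>\<open>k\<close> is a unit square root of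
    \<open>Complex \<sigma> \<gamma>\<close>. Multiplying the base vector by it gives
    \<open>X (0, 0)\<close> the real coordinates \<open>Re k\<close> and \<open>- Im k\<close>,
    which satisfy the initial equation.\<close>
  define k where "k = Complex (1 + \<sigma>) \<gamma> / of_real (sqrt (2 * (1 + \<sigma>)))"
  have "(norm k)\<^sup>2 = ((1 + \<sigma>)\<^sup>2 + \<gamma>\<^sup>2) / (2 * (1 + \<sigma>))"
    using \<sigma>(1) by (simp add: k_def norm_divide power_divide cmod_power2)
  also have "(1 + \<sigma>)\<^sup>2 + \<gamma>\<^sup>2 = 2 * (1 + \<sigma>)" using \<sigma>(2) by (simp add: power2_eq_square algebra_simps)
  finally have k1: "(norm k)\<^sup>2 = 1" using \<sigma>(1) by simp
  define \<alpha> \<beta> where "\<alpha> = k * fst (X (0, 0))" and "\<beta> = k * snd (X (0, 0))"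
  have X0: "(norm (fst (X (0, 0))))\<^sup>2 + (norm (snd (X (0, 0))))\<^sup>2 = 1"
    using sph[OF bd(1)[of 0]] by (simp add: norm_prod_def real_sqrt_eq_1_iff)
  have \<alpha>\<beta>: "(norm \<alpha>)\<^sup>2 + (norm \<beta>)\<^sup>2 = 1"
    using k1 X0 by (simp add: \<alpha>_def \<beta>_def norm_mult power_mult_distrib)
  define A where "A = adapted e \<alpha> \<beta>"
  interpret A: bounded_linear A unfolding A_def by (rule bounded_linear_adapted)
  have bl: "bounded_linear (\<lambda>x. fst (A x))" "bounded_linear (\<lambda>x. snd (A x))"
    using bounded_linear_compose[OF bounded_linear_fst A.bounded_linear_axioms]
      bounded_linear_compose[OF bounded_linear_snd A.bounded_linear_axioms] by simp_all
  \<comment> \<open>\<open>rotJ_tangent\<close> expresses \<open>v\<close> through \<open>u\<close>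
    and \<open>rotJ e u\<close>; in adapted coordinates \<open>rotJ e\<close> is multiplication by
    \<open>\<i>\<close>, and this is the resulting factor.\<close>
  define \<mu> where "\<mu> p = (of_real (u p \<bullet> v p) + \<i> * of_real (q p)) / of_real (u p \<bullet> u p)" for p
  have \<mu>: "Im (\<mu> p) > 0" if "p \<in> strip" for p
    using q[OF that] u0[OF that] by (simp add: \<mu>_def)
  have CR: "fst (A (v p)) = \<mu> p * fst (A (u p))" "snd (A (v p)) = \<mu> p * snd (A (u p))" if p: "p \<in> strip" for p
  proof -
    have "A (q p *\<^sub>R rotJ e (u p)) = A ((u p \<bullet> u p) *\<^sub>R v p - (u p \<bullet> v p) *\<^sub>R u p)"
      unfolding rotJ_tangent(1)[OF lag0[OF p] D[OF p]] ..
    then have *: "q p *\<^sub>R A (rotJ e (u p)) = (u p \<bullet> u p) *\<^sub>R A (v p) - (u p \<bullet> v p) *\<^sub>R A (u p)"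
      by (simp add: A.scale A.diff)
    have "of_real (u p \<bullet> u p) * fst (A (v p)) = (of_real (u p \<bullet> v p) + \<i> * of_real (q p)) * fst (A (u p))"
      using arg_cong[OF *, of fst] unfolding A_def
      by (simp add: adapted_rotJ[OF e] scaleR_conv_of_real algebra_simps)
    moreover have "of_real (u p \<bullet> u p) * snd (A (v p)) = (of_real (u p \<bullet> v p) + \<i> * of_real (q p)) * snd (A (u p))"
      using arg_cong[OF *, of snd] unfolding A_def
      by (simp add: adapted_rotJ[OF e] scaleR_conv_of_real algebra_simps)
    moreover have "complex_of_real (u p \<bullet> u p) \<noteq> 0" using u0[OF p] by simp
    ultimately show "fst (A (v p)) = \<mu> p * fst (A (u p))" "snd (A (v p)) = \<mu> p * snd (A (u p))"
      unfolding \<mu>_def by (simp_all add: eq_divide_eq mult.commute)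
  qed
  have cu: "continuous_on strip u" "continuous_on strip v"
    using strip_partials_continuous[OF u] strip_partials_continuous[OF v] .
  have hz: "holo_partials \<mu> (\<lambda>p. fst (A (X p))) (\<lambda>p. fst (A (u p))) (\<lambda>p. fst (A (v p)))"
    unfolding holo_partials_def
    by (intro conjI strip_partials_linear[OF bl(1) X] bounded_linear.continuous_on[OF bl(1)] cu) (auto simp: CR)
  have hw: "holo_partials \<mu> (\<lambda>p. snd (A (X p))) (\<lambda>p. snd (A (u p))) (\<lambda>p. snd (A (v p)))"
    unfolding holo_partials_def
    by (intro conjI strip_partials_linear[OF bl(2) X] bounded_linear.continuous_on[OF bl(2)] cu) (auto simp: CR)
  have im: "fst (A (u p)) \<noteq> 0 \<or> snd (A (u p)) \<noteq> 0" if "p \<in> strip" for p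
  proof -
    have "norm (A (u p)) = norm (u p)" unfolding A_def by (rule adapted_norm[OF e \<alpha>\<beta>])
    then show ?thesis using u0[OF that] by (auto simp: norm_prod_def prod_eq_iff)
  qed
  \<comment> \<open>Second derivatives of \<open>z\<close> are supplied for the rotation numbers in
    \<open>no_flat_annulus\<close>.\<close>
  have z2: "strip_partials (\<lambda>p. fst (A (v p))) (\<lambda>p. fst (A (b p))) (\<lambda>p. fst (A (d p)))"
    by (rule strip_partials_linear[OF bl(1) v])
  have z22: "continuous_on strip (\<lambda>p. fst (A (d p)))"
    by (intro bounded_linear.continuous_on[OF bl(1)] cont)
  have b0: "\<exists>r<0. fst (A (v (0, t))) = \<i> * of_real r * (of_real \<sigma> * fst (A (X (0, t))) - of_real \<gamma> * cnj (snd (A (X (0, t))))) \<and>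
                snd (A (v (0, t))) = \<i> * of_real r * (of_real \<sigma> * snd (A (X (0, t))) + of_real \<gamma> * cnj (fst (A (X (0, t)))))" for t
    using adapted_boundary[OF X st(1) lag0[OF st(1)] D[OF st(1)] e q[OF st(1)] v0[OF st(1)] n0[of t], of \<alpha> \<beta>]
    unfolding A_def \<sigma>_def \<gamma>_def by simp
  have b1: "\<exists>r>0. fst (A (v (1, t))) = \<i> * of_real r * (of_real (sin \<theta>1) * fst (A (X (1, t))) - of_real (cos \<theta>1) * cnj (snd (A (X (1, t))))) \<and>
                snd (A (v (1, t))) = \<i> * of_real r * (of_real (sin \<theta>1) * snd (A (X (1, t))) + of_real (cos \<theta>1) * cnj (fst (A (X (1, t)))))" for t
    using adapted_boundary[OF X st(2) lag0[OF st(2)] D[OF st(2)] e q[OF st(2)] v0[OF st(2)] n1[of t], of \<alpha> \<beta>]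
    unfolding A_def by simp
  have "A (X (0, 0)) = (of_real (Re k), - of_real (Im k))"
  proof -
    have 0: "fst (X (0, 0)) * cnj (fst (X (0, 0))) + snd (X (0, 0)) * cnj (snd (X (0, 0))) = 1"
      using X0 by (metis complex_norm_square of_real_1 of_real_add)
    have 1: "fst (X (0, 0)) * cnj \<alpha> + snd (X (0, 0)) * cnj \<beta> = cnj k"
    proof -
      have "fst (X (0, 0)) * cnj \<alpha> + snd (X (0, 0)) * cnj \<beta>
        = cnj k * (fst (X (0, 0)) * cnj (fst (X (0, 0))) + snd (X (0, 0)) * cnj (snd (X (0, 0))))"
        by (simp add: \<alpha>_def \<beta>_def algebra_simps)
      then show ?thesis unfolding 0 by simp
    qed
    have 2: "snd (X (0, 0)) * \<alpha> - fst (X (0, 0)) * \<beta> = 0" by (simp add: \<alpha>_def \<beta>_def)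
    show ?thesis unfolding A_def adapted_def Let_def 1 2 by (simp add: complex_eq_iff)
  qed
  moreover have "Re k = (1 + \<sigma>) / sqrt (2 * (1 + \<sigma>))" "Im k = \<gamma> / sqrt (2 * (1 + \<sigma>))"
    by (simp_all add: k_def)
  then have "(1 + \<sigma>) * Im k = \<gamma> * Re k" by simp
  ultimately have init: "of_real (1 + \<sigma>) * snd (A (X (0, 0))) + of_real \<gamma> * cnj (fst (A (X (0, 0)))) = 0"
    by (simp add: complex_eq_iff)
  show thesis
  proof (rule that[OF e \<alpha>\<beta> _ \<mu> hz hw im z2 z22 \<sigma> s(2) _ b0 b1 sph init])
    show "adapted e \<alpha> \<beta> (X p) = (fst (A (X p)), snd (A (X p)))" for p by (simp add: A_def)
  qed auto
qed

section \<open>The boundary curve is a circle on a catenoid\<close>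

text \<open>The left side \<open>B\<close> solves \<open>B' = \<i> r B\<close> with real
  \<open>r\<close>, so its modulus is constant, and it vanishes at \<open>t = 0\<close>.\<close>

lemma boundary_circle:
  assumes z: "strip_partials z z1 z2" and w: "strip_partials w w1 w2"
    and \<sigma>: "\<sigma>\<^sup>2 + \<gamma>\<^sup>2 = 1"
    and bd: "\<And>t. \<exists>r. z2 (0, t) = \<i> * of_real r * (of_real \<sigma> * z (0, t) - of_real \<gamma> * cnj (w (0, t))) \<and>
                w2 (0, t) = \<i> * of_real r * (of_real \<sigma> * w (0, t) + of_real \<gamma> * cnj (z (0, t)))"
    and init: "of_real (1 + \<sigma>) * w (0, 0) + of_real \<gamma> * cnj (z (0, 0)) = 0"
  shows "of_real (1 + \<sigma>) * w (0, t) + of_real \<gamma> * cnj (z (0, t)) = 0"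
proof -
  define B where "B t = of_real (1 + \<sigma>) * w (0, t) + of_real \<gamma> * cnj (z (0, t))" for t
  define B' where "B' t = of_real (1 + \<sigma>) * w2 (0, t) + of_real \<gamma> * cnj (z2 (0, t))" for t
  have dB: "(B has_vector_derivative B' t) (at t within UNIV)" for t
  proof -
    have dz: "((\<lambda>t. z (0, t)) has_vector_derivative z2 (0, t)) (at t)"
      and dw: "((\<lambda>t. w (0, t)) has_vector_derivative w2 (0, t)) (at t)"
      by (rule strip_partials_vector2[OF z] strip_partials_vector2[OF w]; simp)+
    show ?thesis
      unfolding B_def[abs_def] B'_def
      by (intro has_vector_derivative_add has_vector_derivative_mult_right has_vector_derivative_cnj dz dw)
  qed
  have "((\<lambda>t. B t * cnj (B t)) has_vector_derivative 0) (at t within UNIV)" for t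
  proof -
    obtain r where r: "z2 (0, t) = \<i> * of_real r * (of_real \<sigma> * z (0, t) - of_real \<gamma> * cnj (w (0, t)))"
      "w2 (0, t) = \<i> * of_real r * (of_real \<sigma> * w (0, t) + of_real \<gamma> * cnj (z (0, t)))"
      using bd by blast
    \<comment> \<open>The coefficient of \<open>w\<close> is again \<open>1 + \<sigma>\<close>,
      because \<open>\<sigma>\<^sup>2 + \<gamma>\<^sup>2 = 1\<close>.\<close>
    have "B' t = \<i> * of_real r * (of_real (\<sigma> + (\<sigma>\<^sup>2 + \<gamma>\<^sup>2)) * w (0, t) + of_real \<gamma> * cnj (z (0, t)))"
      unfolding B'_def r by (simp add: algebra_simps power2_eq_square)
    then have "B' t = \<i> * of_real r * B t" unfolding \<sigma> B_def by (simp add: algebra_simps)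
    then have "B t * cnj (B' t) + B' t * cnj (B t) = 0" by simp
    moreover have "((\<lambda>t. B t * cnj (B t)) has_vector_derivative B t * cnj (B' t) + B' t * cnj (B t)) (at t within UNIV)"
      by (intro has_vector_derivative_mult has_vector_derivative_cnj dB)
    ultimately show ?thesis by simp
  qed
  then obtain k where "\<And>t. t \<in> UNIV \<Longrightarrow> B t * cnj (B t) = k"
    using has_vector_derivative_zero_constant[OF convex_UNIV, of "\<lambda>t. B t * cnj (B t)"] by blast
  then have "B t * cnj (B t) = B 0 * cnj (B 0)" by simp
  moreover have "B 0 = 0" using init by (simp add: B_def)
  ultimately have "B t = 0" by simp
  then show ?thesis unfolding B_def .
qed

text \<open>The plane equation makes \<open>w\<close> a real multiple of \<open>cnj z\<close>, so
  \<open>z * w\<close> is a real multiple of the squared modulus of \<open>z\<close>, which the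
  sphere equation determines as \<open>(1 + \<sigma>) / 2\<close>.\<close>

lemma boundary_circle_product:
  assumes B: "of_real (1 + \<sigma>) * w + of_real \<gamma> * cnj z = 0"
    and \<sigma>: "\<sigma> \<ge> 0" "\<sigma>\<^sup>2 + \<gamma>\<^sup>2 = 1" and n: "(norm z)\<^sup>2 + (norm w)\<^sup>2 = 1"
  shows "z * w = of_real (- \<gamma> / 2)"
proof -
  have "of_real (1 + \<sigma>) * w = - (of_real \<gamma> * cnj z)" using B by (simp add: add_eq_0_iff)
  then have w: "w = - of_real (\<gamma> / (1 + \<sigma>)) * cnj z"
  proof -
    have "complex_of_real (1 + \<sigma>) \<noteq> 0" using \<sigma>(1) by (simp only: of_real_eq_0_iff)
    then have "w = (of_real (1 + \<sigma>) * w) / of_real (1 + \<sigma>)" by simp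
    then show ?thesis unfolding \<open>of_real (1 + \<sigma>) * w = _\<close> by simp
  qed
  have "(norm z)\<^sup>2 * (1 + (\<gamma> / (1 + \<sigma>))\<^sup>2) = 1"
  proof -
    have "norm w = \<bar>\<gamma> / (1 + \<sigma>)\<bar> * norm z"
      unfolding w by (simp only: norm_mult norm_minus_cancel norm_of_real complex_mod_cnj)
    then have "(norm w)\<^sup>2 = (\<gamma> / (1 + \<sigma>))\<^sup>2 * (norm z)\<^sup>2"
      by (simp only: power_mult_distrib power2_abs)
    then show ?thesis using n by (simp add: algebra_simps)
  qed
  moreover have "1 + (\<gamma> / (1 + \<sigma>))\<^sup>2 = 2 / (1 + \<sigma>)"
  proof -
    have "\<gamma>\<^sup>2 = (1 - \<sigma>) * (1 + \<sigma>)" using \<sigma>(2) by (simp add: power2_eq_square algebra_simps)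
    then have "(\<gamma> / (1 + \<sigma>))\<^sup>2 = (1 - \<sigma>) / (1 + \<sigma>)"
      using \<sigma>(1) by (simp add: power_divide power2_eq_square)
    then show ?thesis using \<sigma>(1) by (simp add: field_simps)
  qed
  ultimately have "(norm z)\<^sup>2 * (2 / (1 + \<sigma>)) = 1" by metis
  then have nz: "(norm z)\<^sup>2 = (1 + \<sigma>) / 2" using \<sigma>(1) by (simp add: field_simps)
  have "z * w = - of_real (\<gamma> / (1 + \<sigma>)) * (z * cnj z)" unfolding w by simp
  also have "\<dots> = - of_real (\<gamma> / (1 + \<sigma>)) * of_real ((1 + \<sigma>) / 2)"
    by (simp add: complex_norm_square[symmetric] nz)
  also have "\<dots> = of_real (- (\<gamma> / (1 + \<sigma>) * ((1 + \<sigma>) / 2)))"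
    by (simp only: of_real_mult of_real_minus mult_minus_left)
  also have "- (\<gamma> / (1 + \<sigma>) * ((1 + \<sigma>) / 2)) = - \<gamma> / 2" using \<sigma>(1) by simp
  finally show ?thesis .
qed


section \<open>Exclusion of the flat case\<close>

text \<open>The velocity of a curve running counterclockwise on the unit circle itself turns
  counterclockwise: differentiating \<open>Re (c1 t * cnj (c t)) = 0\<close> leads to the value
  \<open>norm (c1 t) ^ 3\<close> for \<open>Im (c2 t * cnj (c1 t))\<close>.\<close>

lemma winding_number_velocity_pos:
  fixes c :: "real \<Rightarrow> complex"
  assumes c: "\<And>t. (c has_vector_derivative c1 t) (at t)" and c1: "\<And>t. (c1 has_vector_derivative c2 t) (at t)"
    and cont: "continuous_on UNIV c2" and n: "\<And>t. norm (c t) = 1"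
    and r: "\<And>t. r t > 0" "\<And>t. c1 t = \<i> * of_real (r t) * c t"
  shows "Re (winding_number (\<lambda>t. c1 (2 * pi * t)) 0) > 0"
proof -
  have contc: "continuous_on UNIV c1"
    using c1 by (auto intro!: continuous_at_imp_continuous_on has_vector_derivative_continuous)
  have der: "((\<lambda>t. c1 (2 * pi * t)) has_vector_derivative (2 * pi) *\<^sub>R c2 (2 * pi * t)) (at t)" for t
    by (rule vector_diff_chain_at[of "\<lambda>t. 2 * pi * t" "2 * pi" t c1, unfolded o_def, OF _ c1])
       (auto intro!: derivative_eq_intros)
  have nr: "norm (c1 t) = r t" for t using r(1)[of t] n[of t] by (simp add: r(2) norm_mult)
  have Re0: "Re (c1 t * cnj (c t)) = 0" for t
  proof -
    have "c1 t * cnj (c t) = \<i> * of_real (r t) * (c t * cnj (c t))" by (simp add: r(2))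
    also have "c t * cnj (c t) = 1" using n[of t] by (metis complex_norm_square of_real_1 one_power2)
    finally show ?thesis by simp
  qed
  have Re2: "Re (c2 t * cnj (c t)) = - (r t)\<^sup>2" for t
  proof -
    have "((\<lambda>t. Re (c1 t * cnj (c t))) has_vector_derivative Re (c1 t * cnj (c1 t) + c2 t * cnj (c t))) (at t)"
      by (intro bounded_linear.has_vector_derivative[OF bounded_linear_Re] has_vector_derivative_mult has_vector_derivative_cnj c c1)
    moreover have "((\<lambda>t. Re (c1 t * cnj (c t))) has_vector_derivative 0) (at t)"
      unfolding Re0 by simp
    ultimately have "Re (c1 t * cnj (c1 t) + c2 t * cnj (c t)) = 0" by (rule vector_derivative_unique_at)
    moreover have "Re (c1 t * cnj (c1 t)) = (r t)\<^sup>2"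
      by (simp add: complex_norm_square[symmetric] nr flip: of_real_power)
    ultimately show ?thesis by simp
  qed
  have Im2: "Im (c2 t * cnj (c1 t)) = (norm (c1 t)) ^ 3" for t
  proof -
    have "c2 t * cnj (c1 t) = (- \<i> * of_real (r t)) * (c2 t * cnj (c t))" by (simp add: r(2))
    then have "Im (c2 t * cnj (c1 t)) = - (r t * Re (c2 t * cnj (c t)))" by simp
    then show ?thesis unfolding Re2 nr by (simp add: power2_eq_square power3_eq_cube)
  qed
  \<comment> \<open>The criterion for a positive winding number asks for a uniform lower bound,
    which the minimal speed provides.\<close>
  obtain m where m: "m \<in> {0..2*pi}" "\<And>t. t \<in> {0..2*pi} \<Longrightarrow> norm (c1 m) \<le> norm (c1 t)"
    using continuous_attains_inf[of "{0..2*pi}" "\<lambda>t. norm (c1 t)"]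
      continuous_on_norm[OF continuous_on_subset[OF contc subset_UNIV]] by auto
  show ?thesis
  proof (rule winding_number_pos_lt[where e = "2 * pi * norm (c1 m) ^ 3"])
    have "(\<lambda>t. c1 (2 * pi * t)) C1_differentiable_on {0..1}"
      unfolding C1_differentiable_on_def
      by (intro exI[of _ "\<lambda>t. (2 * pi) *\<^sub>R c2 (2 * pi * t)"] conjI ballI der continuous_intros
            continuous_on_compose2[OF cont]) auto
    then show "valid_path (\<lambda>t. c1 (2 * pi * t))"
      unfolding valid_path_def by (rule C1_differentiable_imp_piecewise)
    show "0 \<notin> path_image (\<lambda>t. c1 (2 * pi * t))"
      using nr r(1) by (auto simp: path_image_def) (metis norm_zero less_irrefl)
    show "0 < 2 * pi * norm (c1 m) ^ 3" using nr[of m] r(1)[of m] by simp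
    show "2 * pi * norm (c1 m) ^ 3 \<le> Im (vector_derivative (\<lambda>t. c1 (2 * pi * t)) (at t) * cnj (c1 (2 * pi * t) - 0))"
      if t: "0 < t" "t < 1" for t
    proof -
      have "norm (c1 m) ^ 3 \<le> norm (c1 (2 * pi * t)) ^ 3"
        using t by (intro power_mono m(2)) auto
      then have "2 * pi * norm (c1 m) ^ 3 \<le> 2 * pi * Im (c2 (2 * pi * t) * cnj (c1 (2 * pi * t)))"
        unfolding Im2 by simp
      then show ?thesis unfolding vector_derivative_at[OF der] by simp
    qed
  qed
qed

text \<open>The loops \<open>t \<mapsto> z2 (s, t)\<close> avoid \<open>0\<close>, so their winding number does not depend on \<open>s\<close>;
  but the two boundary circles are traversed in opposite directions.\<close>

lemma no_flat_annulus:
  fixes z :: "real \<times> real \<Rightarrow> complex"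
  assumes z: "strip_partials z z1 z2" and z2: "strip_partials z2 z21 z22" and c22: "continuous_on strip z22"
    and ne: "\<And>p. p \<in> strip \<Longrightarrow> z2 p \<noteq> 0"
    and per: "\<And>s t. 0 \<le> s \<Longrightarrow> s \<le> 1 \<Longrightarrow> z2 (s, t + 2 * pi) = z2 (s, t)"
    and n: "\<And>p. p \<in> strip_boundary \<Longrightarrow> norm (z p) = 1"
    and b0: "\<And>t. \<exists>r<0. z2 (0, t) = \<i> * of_real r * z (0, t)"
    and b1: "\<And>t. \<exists>r>0. z2 (1, t) = \<i> * of_real r * z (1, t)"
  shows False
proof -
  define g where "g s t = z2 (s, 2 * pi * t)" for s t :: real
  have bd: "(0, t) \<in> strip_boundary" "(1, t) \<in> strip_boundary" for t by (auto simp: strip_boundary_def)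
  have cs: "continuous_on UNIV (\<lambda>t. z22 (s, t))" if "0 \<le> s" "s \<le> 1" for s
    by (rule continuous_on_compose2[OF c22]) (use that in \<open>auto simp: strip_def intro!: continuous_intros\<close>)
  have d: "((\<lambda>t. z (s, t)) has_vector_derivative z2 (s, t)) (at t)"
     "((\<lambda>t. z2 (s, t)) has_vector_derivative z22 (s, t)) (at t)" if "0 \<le> s" "s \<le> 1" for s t
    using strip_partials_vector2[OF z that] strip_partials_vector2[OF z2 that] by auto
  have contz: "continuous_on strip z2" by (rule strip_partials_continuous[OF z2])
  have path: "path (g s)" if "0 \<le> s" "s \<le> 1" for s
    unfolding path_def g_def
    by (rule continuous_on_compose2[OF contz]) (use that in \<open>auto simp: strip_def intro!: continuous_intros\<close>)
  have g0: "0 \<notin> path_image (g s)" if "0 \<le> s" "s \<le> 1" for s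
    using ne that by (auto simp: path_image_def g_def strip_def)
  obtain r1 where r1: "\<And>t. r1 t > 0" "\<And>t. z2 (1, t) = \<i> * of_real (r1 t) * z (1, t)" using b1 by metis
  obtain r0 where r0: "\<And>t. r0 t < 0" "\<And>t. z2 (0, t) = \<i> * of_real (r0 t) * z (0, t)" using b0 by metis
  have pos: "Re (winding_number (g 1) 0) > 0"
    unfolding g_def
    by (rule winding_number_velocity_pos[where c = "\<lambda>t. z (1, t)" and r = r1 and ?c2.0 = "\<lambda>t. z22 (1, t)"])
       (auto intro!: d cs n bd r1)
  \<comment> \<open>The circle \<open>s = 0\<close> runs clockwise; conjugation reverses it and
    negates the real part of the winding number.\<close>
  have "Re (winding_number (\<lambda>t. cnj (z2 (0, 2 * pi * t))) 0) > 0"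
    by (rule winding_number_velocity_pos[where c = "\<lambda>t. cnj (z (0, t))" and r = "\<lambda>t. - r0 t" and ?c2.0 = "\<lambda>t. cnj (z22 (0, t))"])
       (use r0 in \<open>simp_all add: has_vector_derivative_cnj d cs n bd continuous_on_cnj flip: r0(2)\<close>, simp add: r0(2))
  then have "Re (winding_number (cnj \<circ> g 0) (cnj 0)) > 0" by (simp add: g_def o_def)
  then have neg: "Re (winding_number (g 0) 0) < 0"
    using winding_number_cnj[OF path g0, of 0] by simp
  \<comment> \<open>The homotopy parameter is \<open>s\<close>; the intermediate curves are closed
    by \<open>per\<close> and avoid \<open>0\<close> by \<open>ne\<close>.\<close>
  have "homotopic_loops (- {0}) (g 0) (g 1)"
    unfolding homotopic_loops
  proof (intro exI[of _ "\<lambda>x. g (fst x) (snd x)"] conjI)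
    show "continuous_on ({0..1} \<times> {0..1}) (\<lambda>x. g (fst x) (snd x))"
      unfolding g_def
      by (rule continuous_on_compose2[OF contz]) (auto simp: strip_def intro!: continuous_intros)
    show "(\<lambda>x. g (fst x) (snd x)) \<in> {0..1} \<times> {0..1} \<rightarrow> - {0}"
      using ne by (auto simp: g_def strip_def)
    show "\<forall>t\<in>{0..1}. pathfinish ((\<lambda>x. g (fst x) (snd x)) \<circ> Pair t) = pathstart ((\<lambda>x. g (fst x) (snd x)) \<circ> Pair t)"
      using per[of _ 0] by (simp add: pathfinish_def pathstart_def g_def)
  qed auto
  then have "winding_number (g 0) 0 = winding_number (g 1) 0"
    by (rule winding_number_homotopic_loops)
  with pos neg show False by simp
qed


section \<open>The image is the catenoid in the ball\<close>

text \<open>Multiplying \<open>N - 1\<close> by \<open>x\<close>, the squared modulus of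
  \<open>y\<close>, gives a quadratic polynomial in \<open>x\<close> with roots
  \<open>(1 - \<sigma>) / 2\<close> and \<open>(1 + \<sigma>) / 2\<close>.\<close>

lemma catenoid_norm:
  assumes y: "y \<noteq> (0::complex)" and \<sigma>: "\<sigma> \<ge> 0" "\<sigma>\<^sup>2 + \<gamma>\<^sup>2 = 1"
  defines "N \<equiv> (norm y)\<^sup>2 + (norm (of_real (- \<gamma> / 2) / y))\<^sup>2"
  shows "N \<le> 1 \<longleftrightarrow> (1 - \<sigma>) / 2 \<le> (norm y)\<^sup>2 \<and> (norm y)\<^sup>2 \<le> (1 + \<sigma>) / 2"
    and "N < 1 \<longleftrightarrow> (1 - \<sigma>) / 2 < (norm y)\<^sup>2 \<and> (norm y)\<^sup>2 < (1 + \<sigma>) / 2"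
proof -
  define x where "x = (norm y)\<^sup>2"
  have x: "x > 0" using y by (simp add: x_def)
  have N: "N = x + (\<gamma> / 2)\<^sup>2 / x"
    unfolding N_def x_def by (simp add: norm_divide norm_mult power_divide)
  have "(N - 1) * x = x\<^sup>2 - x + \<gamma>\<^sup>2 / 4" using x unfolding N by (simp add: field_simps power2_eq_square)
  also have "\<gamma>\<^sup>2 = 1 - \<sigma>\<^sup>2" using \<sigma>(2) by simp
  finally have *: "(N - 1) * x = (x - (1 - \<sigma>) / 2) * (x - (1 + \<sigma>) / 2)"
    by (simp add: field_simps power2_eq_square)
  have "N \<le> 1 \<longleftrightarrow> (N - 1) * x \<le> 0" using x by (simp add: mult_le_0_iff)
  also have "\<dots> \<longleftrightarrow> (1 - \<sigma>) / 2 \<le> x \<and> x \<le> (1 + \<sigma>) / 2"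
    unfolding * mult_le_0_iff using \<sigma>(1) by auto
  finally show "N \<le> 1 \<longleftrightarrow> (1 - \<sigma>) / 2 \<le> (norm y)\<^sup>2 \<and> (norm y)\<^sup>2 \<le> (1 + \<sigma>) / 2"
    by (simp add: x_def)
  have "N < 1 \<longleftrightarrow> (N - 1) * x < 0" using x by (simp add: mult_less_0_iff)
  also have "\<dots> \<longleftrightarrow> (1 - \<sigma>) / 2 < x \<and> x < (1 + \<sigma>) / 2"
    unfolding * mult_less_0_iff using \<sigma>(1) by auto
  finally show "N < 1 \<longleftrightarrow> (1 - \<sigma>) / 2 < (norm y)\<^sup>2 \<and> (norm y)\<^sup>2 < (1 + \<sigma>) / 2"
    by (simp add: x_def)
qed

text \<open>\<open>z\<close> is a local homeomorphism: its Jacobian is \<open>Im \<mu>\<close> times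
  the squared modulus of \<open>z1\<close>.\<close>

lemma holo_partials_open_image:
  assumes \<mu>: "\<And>p. p \<in> strip \<Longrightarrow> Im (\<mu> p) > 0" and z: "holo_partials \<mu> z z1 z2"
    and ne: "\<And>p. p \<in> strip \<Longrightarrow> z1 p \<noteq> 0"
  shows "open (z ` ({0<..<1} \<times> UNIV))"
proof -
  define U :: "(real \<times> real) set" where "U = {0<..<1} \<times> UNIV"
  have U: "open U" "U \<subseteq> strip" unfolding U_def strip_def by (auto intro: open_Times)
  have sz: "strip_partials z z1 z2" using z by (simp add: holo_partials_def)
  have der: "(z has_derivative (\<lambda>h. fst h *\<^sub>R z1 p + snd h *\<^sub>R z2 p)) (at p)" if "p \<in> U" for p
  proof -
    have "p \<in> strip" using that U(2) by blast
    then have "(z has_derivative (\<lambda>h. fst h *\<^sub>R z1 p + snd h *\<^sub>R z2 p)) (at p within U)"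
      by (rule has_derivative_subset[OF strip_partialsD[OF sz] U(2)])
    then show ?thesis unfolding at_within_open[OF that U(1)] .
  qed
  show ?thesis
    unfolding U_def[symmetric] open_subopen[of "z ` U"]
  proof
    fix y assume "y \<in> z ` U"
    then obtain p where p: "p \<in> U" "y = z p" by blast
    then have st: "p \<in> strip" using U by blast
    have "z2 p = \<mu> p * z1 p" using z st by (simp add: holo_partials_def)
    then have "Im (cnj (z1 p) * z2 p) = Im (\<mu> p) * (norm (z1 p))\<^sup>2"
      unfolding cmod_power2 by (simp add: power2_eq_square algebra_simps)
    then have "Im (cnj (z1 p) * z2 p) \<noteq> 0" using \<mu>[OF st] ne[OF st] by simp
    moreover have "continuous_on U z1" "continuous_on U z2"
      using z U(2) by (auto simp: holo_partials_def intro: continuous_on_subset)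
    ultimately obtain U' V g where "U' \<subseteq> U" "p \<in> U'" "open V" "homeomorphism U' V z g"
      using plane_inverse_function[OF U(1) p(1) der] by metis
    then show "\<exists>T. open T \<and> y \<in> T \<and> T \<subseteq> z ` U"
      unfolding homeomorphism_def p(2) by (intro exI[of _ V]) auto
  qed
qed

text \<open>The image of the open strip is open, and that of the closed strip is compact. As the
  sides go to the two circles, the image is open and closed in the open annulus
  \<open>\<Omega>\<close> between them and covers it; closedness then adds the circles.\<close>

lemma catenoid_image:
  fixes z :: "real \<times> real \<Rightarrow> complex"
  assumes \<mu>: "\<And>p. p \<in> strip \<Longrightarrow> Im (\<mu> p) > 0" and z: "holo_partials \<mu> z z1 z2"
    and ne: "\<And>p. p \<in> strip \<Longrightarrow> z1 p \<noteq> 0"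
    and per: "\<And>s t. z (s, t + 2 * pi) = z (s, t)"
    and r: "0 \<le> r1"
    and bd: "\<And>p. p \<in> strip_boundary \<Longrightarrow> norm (z p) = r1 \<or> norm (z p) = r2"
    and im: "\<And>p. p \<in> strip \<Longrightarrow> r1 \<le> norm (z p) \<and> norm (z p) \<le> r2"
  shows "r1 < r2" "z ` strip = {y. r1 \<le> norm y \<and> norm y \<le> r2}"
proof -
  define I :: "(real \<times> real) set" where "I = {0<..<1} \<times> UNIV"
  define \<Omega> :: "complex set" where "\<Omega> = {y. r1 < norm y \<and> norm y < r2}"
  have st: "strip = I \<union> strip_boundary" by (auto simp: I_def strip_def strip_boundary_def)
  have contz: "continuous_on strip z"
    using z by (auto simp: holo_partials_def intro: strip_partials_continuous)
  \<comment> \<open>Periodicity replaces the strip by a compact rectangle.\<close>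
  have "z ` strip = z ` ({0..1} \<times> {0..2*pi})"
  proof
    show "z ` strip \<subseteq> z ` ({0..1} \<times> {0..2*pi})"
    proof
      fix y assume "y \<in> z ` strip"
      then obtain s t where y: "y = z (s, t)" "0 \<le> s" "s \<le> 1" by (auto simp: strip_def)
      have nat: "z (s, t + 2 * pi * real n) = z (s, t)" for n t
        by (induction n) (use per[of s "t + 2 * pi * real n" for n] in \<open>simp_all add: algebra_simps\<close>)
      have int: "z (s, t + 2 * pi * of_int k) = z (s, t)" for k t
      proof (cases "k \<ge> 0")
        case True then show ?thesis using nat[of t "nat k"] by simp
      next
        case False then show ?thesis using nat[of "t + 2 * pi * of_int k" "nat (- k)"] by simp
      qed
      define k where "k = \<lfloor>t / (2 * pi)\<rfloor>"
      have "of_int k \<le> t / (2 * pi)" "t / (2 * pi) \<le> of_int k + 1" unfolding k_def by linarith+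
      then have "t + 2 * pi * of_int (- k) \<in> {0..2*pi}" by (auto simp: field_simps)
      then show "y \<in> z ` ({0..1} \<times> {0..2*pi})"
        using y int[of t "- k"] by (intro image_eqI[of _ _ "(s, t + 2 * pi * of_int (- k))"]) auto
    qed
  qed (auto simp: strip_def)
  moreover have "compact (z ` ({0..1} \<times> {0..2*pi}))"
    by (intro compact_continuous_image continuous_on_subset[OF contz] compact_Times) (auto simp: strip_def)
  ultimately have cl: "closed (z ` strip)" by (simp add: compact_imp_closed)
  have oI: "open (z ` I)" unfolding I_def by (rule holo_partials_open_image[OF \<mu> z ne])
  have Ine: "z ` I \<noteq> {}" by (auto simp: I_def intro!: exI[of _ "1/2"])
  \<comment> \<open>Circles have measure zero and nonempty open sets do not. This yields a point of
    the image strictly between the radii, and with it \<open>r1 < r2\<close>.\<close>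
  have nosub: "\<not> z ` I \<subseteq> sphere 0 r1 \<union> sphere 0 r2"
    using open_not_negligible[OF oI Ine] negligible_subset[OF negligible_Un[OF negligible_sphere negligible_sphere]]
    by metis
  then obtain p where p: "p \<in> I" "z p \<notin> sphere 0 r1 \<union> sphere 0 r2" by blast
  then have p: "p \<in> I" "norm (z p) \<noteq> r1" "norm (z p) \<noteq> r2" by auto
  moreover have "p \<in> strip" using p(1) st by blast
  then have "r1 \<le> norm (z p)" "norm (z p) \<le> r2" using im[of p] by blast+
  ultimately have p: "p \<in> I" "z p \<in> \<Omega>" by (auto simp: \<Omega>_def)
  then show "r1 < r2" unfolding \<Omega>_def by (blast intro: less_trans)
  have o\<Omega>: "open \<Omega>" unfolding \<Omega>_def by (intro open_Collect_conj open_Collect_less continuous_intros)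
  have c\<Omega>: "connected \<Omega>"
    using connected_annulus(1)[of r1 "0::complex" r2] by (simp add: \<Omega>_def)
  \<comment> \<open>The sides map outside \<open>\<Omega>\<close>, so inside it the images of the
    closed and of the open strip coincide.\<close>
  have eq: "\<Omega> \<inter> z ` strip = \<Omega> \<inter> z ` I"
    unfolding st using bd by (fastforce simp: \<Omega>_def)
  have "\<Omega> \<subseteq> z ` strip"
  proof (rule ccontr)
    assume "\<not> \<Omega> \<subseteq> z ` strip"
    moreover have "open (\<Omega> \<inter> z ` I)" "open (\<Omega> \<inter> - (z ` strip))"
      using o\<Omega> oI cl by (auto intro!: open_Int)
    moreover have "\<Omega> \<inter> z ` I \<noteq> {}" using p by blast
    ultimately show False
      using connectedD[OF c\<Omega>, of "\<Omega> \<inter> z ` I" "\<Omega> \<inter> - (z ` strip)"] eq by blast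
  qed
  have "y \<in> z ` strip" if y: "r1 \<le> norm y" "norm y \<le> r2" for y
  proof -
    \<comment> \<open>Points on the bounding circles are reached as radial limits within the closed
      image. At \<open>y = 0\<close> any unit direction will do, and \<open>1\<close> is
      taken.\<close>
    define e :: complex where "e = (if y = 0 then 1 else sgn y)"
    have e: "norm e = 1" "y = norm y *\<^sub>R e" by (auto simp: e_def norm_sgn sgn_div_norm)
    have "(\<lambda>x. x *\<^sub>R e) ` closure {r1<..<r2} \<subseteq> z ` strip"
    proof (rule image_closure_subset[OF _ cl])
      show "(\<lambda>x. x *\<^sub>R e) ` {r1<..<r2} \<subseteq> z ` strip"
        using \<open>\<Omega> \<subseteq> z ` strip\<close> e(1) r by (auto simp: \<Omega>_def subset_iff)
    qed (intro continuous_intros)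
    moreover have "closure {r1<..<r2} = {r1..r2}" using \<open>r1 < r2\<close> by simp
    moreover have "norm y \<in> {r1..r2}" using y by simp
    ultimately have "norm y *\<^sub>R e \<in> z ` strip" by blast
    then show ?thesis using e(2) by simp
  qed
  then show "z ` strip = {y. r1 \<le> norm y \<and> norm y \<le> r2}" using im by auto
qed

section \<open>Classification\<close>

lemma in_coords_image:
  assumes "compact_annulus \<phi> A"
  shows "in_coords \<phi> x ` strip = x ` A"
proof -
  have A: "A = \<phi> ` ({0..1} \<times> sphere 0 1)"
    using assms by (simp add: compact_annulus_def bij_betw_def)
  have "\<exists>t. y = cis t" if "norm y = 1" for y
    using that cis_Arg[of y] by (metis norm_zero sgn_div_norm inverse_1 scaleR_one zero_neq_one)
  then show ?thesis
    unfolding A by (force simp: in_coords_def strip_def image_iff)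
qed

lemma in_coords_periodic: "in_coords \<phi> x (s, t + 2 * pi) = in_coords \<phi> x (s, t)"
proof -
  have "cis (t + 2 * pi) = cis t" by (simp add: complex_eq_iff)
  then show ?thesis by (simp add: in_coords_def)
qed

lemma strip_partials_periodic:
  assumes f: "strip_partials f f1 f2" and per: "\<And>s t. f (s, t + c) = f (s, t)" and s: "0 \<le> s" "s \<le> 1"
  shows "f2 (s, t + c) = f2 (s, t)"
proof -
  have "((\<lambda>t. f (s, t + c)) has_vector_derivative 1 *\<^sub>R f2 (s, t + c)) (at t)"
    by (rule vector_diff_chain_at[of "\<lambda>t. t + c" 1 t "\<lambda>t. f (s, t)", unfolded o_def])
       (auto intro!: derivative_eq_intros strip_partials_vector2[OF f s])
  then have "((\<lambda>t. f (s, t)) has_vector_derivative f2 (s, t + c)) (at t)" by (simp add: per)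
  then show ?thesis
    using strip_partials_vector2[OF f s] by (rule vector_derivative_unique_at)
qed

lemma strip_partials_zero:
  assumes f: "strip_partials f f1 f2" and 0: "\<And>p. p \<in> strip \<Longrightarrow> f p = 0" and p: "p \<in> strip"
  shows "f1 p = 0" "f2 p = 0"
proof -
  have "strip_partials f (\<lambda>p. 0) (\<lambda>p. 0)"
    unfolding strip_partials_def by (simp, intro ballI has_derivative_transform[OF _ 0 has_derivative_const])
  then have "fst h *\<^sub>R f1 p + snd h *\<^sub>R f2 p = 0" for h
    using strip_partials_differential[OF f p] strip_partials_differential[OF _ p, of f "\<lambda>p. 0" "\<lambda>p. 0"]
    by (metis add_0 scaleR_zero_right)
  from this[of "(1, 0)"] this[of "(0, 1)"] show "f1 p = 0" "f2 p = 0" by simp_all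
qed

text \<open>The classification read on the strip, before the isometry \<open>adapted\<close> is
  undone. \<open>per\<close> makes loops of the lines of constant \<open>s\<close>, and
  \<open>ball\<close> confines \<open>z\<close> to the annulus over which the catenoid lies in the
  ball.\<close>

lemma capillary_minimal_lagrangian_image:
  assumes imm: "immersion X" and min: "minimal X" and lag: "lagrangian X"
    and cap: "legendrian_capillary_boundary X"
    and per: "\<And>s t. X (s, t + 2 * pi) = X (s, t)"
    and ball: "\<And>p. p \<in> strip \<Longrightarrow> norm (X p) \<le> 1"
  obtains e \<alpha> \<beta> l where "norm e = 1" "(norm \<alpha>)\<^sup>2 + (norm \<beta>)\<^sup>2 = 1" "0 < \<bar>l\<bar>" "\<bar>l\<bar> < 1 / 2"
    "(\<lambda>p. adapted e \<alpha> \<beta> (X p)) ` strip = lagrangian_catenoid l \<inter> cball 0 1"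
proof -
  obtain e \<alpha> \<beta> \<mu> z z1 z2 w w1 w2 z21 z22 \<sigma> \<gamma> \<sigma>' \<gamma>' where e: "norm e = 1" "(norm \<alpha>)\<^sup>2 + (norm \<beta>)\<^sup>2 = 1"
    and ad: "\<And>p. adapted e \<alpha> \<beta> (X p) = (z p, w p)"
    and \<mu>: "\<And>p. p \<in> strip \<Longrightarrow> Im (\<mu> p) > 0"
    and z: "holo_partials \<mu> z z1 z2" and w: "holo_partials \<mu> w w1 w2"
    and im: "\<And>p. p \<in> strip \<Longrightarrow> z1 p \<noteq> 0 \<or> w1 p \<noteq> 0"
    and z2: "strip_partials z2 z21 z22" "continuous_on strip z22"
    and \<sigma>: "\<sigma> \<ge> 0" "\<sigma>\<^sup>2 + \<gamma>\<^sup>2 = 1" and \<sigma>': "\<sigma>' \<ge> 0" "\<sigma>'\<^sup>2 + \<gamma>'\<^sup>2 = 1"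
    and b0: "\<And>t. \<exists>r<0. z2 (0, t) = \<i> * of_real r * (of_real \<sigma> * z (0, t) - of_real \<gamma> * cnj (w (0, t))) \<and>
                w2 (0, t) = \<i> * of_real r * (of_real \<sigma> * w (0, t) + of_real \<gamma> * cnj (z (0, t)))"
    and b1: "\<And>t. \<exists>r>0. z2 (1, t) = \<i> * of_real r * (of_real \<sigma>' * z (1, t) - of_real \<gamma>' * cnj (w (1, t))) \<and>
                w2 (1, t) = \<i> * of_real r * (of_real \<sigma>' * w (1, t) + of_real \<gamma>' * cnj (z (1, t)))"
    and sph: "\<And>p. p \<in> strip_boundary \<Longrightarrow> norm (X p) = 1"
    and init: "of_real (1 + \<sigma>) * w (0, 0) + of_real \<gamma> * cnj (z (0, 0)) = 0"
    by (rule adapted_coordinates[OF imm min lag cap]) (rule that; assumption)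
  have sz: "strip_partials z z1 z2" and sw: "strip_partials w w1 w2"
    using z w by (auto simp: holo_partials_def)
  have norm_zw: "(norm (z p))\<^sup>2 + (norm (w p))\<^sup>2 = (norm (X p))\<^sup>2" for p
  proof -
    have "norm (z p, w p) = norm (X p)" using adapted_norm[OF e, of "X p"] by (simp add: ad)
    then show ?thesis by (simp add: norm_prod_def)
  qed
  have bdst: "p \<in> strip" if "p \<in> strip_boundary" for p
    using that by (auto simp: strip_def strip_boundary_def)
  have bd: "(0, t) \<in> strip_boundary" "(1, t) \<in> strip_boundary" for t by (auto simp: strip_boundary_def)
  have perz: "z (s, t + 2 * pi) = z (s, t)" for s t
    using ad[of "(s, t)"] ad[of "(s, t + 2 * pi)"] per[of s t] by simp
  have B: "of_real (1 + \<sigma>) * w (0, t) + of_real \<gamma> * cnj (z (0, t)) = 0" for t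
    by (rule boundary_circle[OF sz sw \<sigma>(2) _ init]) (use b0 in blast)
  \<comment> \<open>\<open>\<gamma> = 0\<close> is the case of a free boundary on
    \<open>s = 0\<close>: that curve lies in the plane \<open>w = 0\<close>, hence so does the
    surface, which \<open>no_flat_annulus\<close> excludes.\<close>
  have "\<gamma> \<noteq> 0"
  proof
    assume \<gamma>: "\<gamma> = 0"
    then have \<sigma>1: "\<sigma> = 1" using \<sigma> by (simp add: power2_eq_1_iff)
    have wb: "w (0, t) = 0" for t using B[of t] by (simp add: \<gamma> \<sigma>1)
    have w0: "w p = 0" if "p \<in> strip" for p
      by (rule unique_continuation_strip[OF \<mu> z w im w wb that])
    have w120: "w1 p = 0" "w2 p = 0" if "p \<in> strip" for p
      using strip_partials_zero[OF sw _ that] w0 by blast+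
    have nz: "norm (z p) = 1" if "p \<in> strip_boundary" for p
      using norm_zw[of p] sph[OF that] w0[OF bdst[OF that]] norm_ge_zero[of "z p"]
      by (auto simp: power2_eq_1_iff simp del: norm_ge_zero)
    have z2ne: "z2 p \<noteq> 0" if "p \<in> strip" for p
    proof -
      have "z1 p \<noteq> 0" using im[OF that] w120[OF that] by simp
      moreover have "\<mu> p \<noteq> 0" using \<mu>[OF that] by auto
      ultimately show ?thesis using z that by (simp add: holo_partials_def)
    qed
    \<comment> \<open>On the other side \<open>w\<close> and \<open>w2\<close> vanish while
      \<open>z\<close> does not, so the boundary equation for \<open>w2\<close> forces the
      coefficient to vanish.\<close>
    have "\<gamma>' = 0"
    proof -
      obtain r where "r > 0" "w2 (1, 0) = \<i> * of_real r * (of_real \<sigma>' * w (1, 0) + of_real \<gamma>' * cnj (z (1, 0)))"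
        using b1 by blast
      moreover have "z (1, 0) \<noteq> 0" using nz[OF bd(2), of 0] by auto
      ultimately show ?thesis
        using w120[OF bdst[OF bd(2)]] w0[OF bdst[OF bd(2)]] by auto
    qed
    then have \<sigma>1': "\<sigma>' = 1" using \<sigma>' by (simp add: power2_eq_1_iff)
    show False
    proof (rule no_flat_annulus[OF sz z2 z2ne _ nz])
      show "z2 (s, t + 2 * pi) = z2 (s, t)" if "0 \<le> s" "s \<le> 1" for s t
        by (rule strip_partials_periodic[OF sz perz that])
      show "\<exists>r<0. z2 (0, t) = \<i> * of_real r * z (0, t)" for t
        using b0[of t] by (auto simp: \<gamma> \<sigma>1)
      show "\<exists>r>0. z2 (1, t) = \<i> * of_real r * z (1, t)" for t
        using b1[of t] by (auto simp: \<open>\<gamma>' = 0\<close> \<sigma>1')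
    qed
  qed
  define l where "l = - \<gamma> / 2"
  have l0: "l \<noteq> 0" using \<open>\<gamma> \<noteq> 0\<close> by (simp add: l_def)
  \<comment> \<open>The defining function of the catenoid satisfies the same equation as
    \<open>z\<close> and \<open>w\<close>, so its vanishing propagates from
    \<open>s = 0\<close>.\<close>
  have hf: "holo_partials \<mu> (\<lambda>p. z p * w p - of_real l) (\<lambda>p. z p * w1 p + z1 p * w p) (\<lambda>p. z p * w2 p + z2 p * w p)"
    by (intro holo_partials_diff_const holo_partials_mult z w)
  have zwb: "z (0, t) * w (0, t) - of_real l = 0" for t
    using boundary_circle_product[OF B \<sigma>] norm_zw[of "(0, t)"] sph[OF bd(1)] by (simp add: l_def)
  have zw: "z p * w p - of_real l = 0" if "p \<in> strip" for p
    by (rule unique_continuation_strip[OF \<mu> z w im hf zwb that])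
  have zne: "z p \<noteq> 0" if "p \<in> strip" for p using zw[OF that] l0 by auto
  have w_eq: "w p = of_real l / z p" if "p \<in> strip" for p
    using zw[OF that] zne[OF that] by (simp add: eq_divide_eq mult.commute)
  \<comment> \<open>By the derivative of \<open>z w = l\<close>, a zero of \<open>z1\<close> would
    be a zero of \<open>w1\<close>, against the immersion property.\<close>
  have z1ne: "z1 p \<noteq> 0" if p: "p \<in> strip" for p
  proof
    assume "z1 p = 0"
    moreover have "z p * w1 p + z1 p * w p = 0"
      by (rule strip_partials_zero(1)[OF conjunct1[OF hf[unfolded holo_partials_def]] _ p]) (rule zw)
    ultimately show False using im[OF p] zne[OF p] by simp
  qed
  \<comment> \<open>The radii of \<open>catenoid_norm\<close>, between which the catenoid lies in
    the ball.\<close>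
  define r1 r2 where "r1 = sqrt ((1 - \<sigma>) / 2)" and "r2 = sqrt ((1 + \<sigma>) / 2)"
  have "\<sigma>\<^sup>2 \<le> 1\<^sup>2" using \<sigma>(2) zero_le_power2[of \<gamma>] unfolding power_one by linarith
  then have \<sigma>le: "\<sigma> \<le> 1" by (rule power2_le_imp_le) simp
  have sq: "sqrt a \<le> norm y \<longleftrightarrow> a \<le> (norm y)\<^sup>2" "norm y \<le> sqrt a \<longleftrightarrow> (norm y)\<^sup>2 \<le> a"
    "sqrt a < norm y \<longleftrightarrow> a < (norm y)\<^sup>2" "norm y < sqrt a \<longleftrightarrow> (norm y)\<^sup>2 < a" for y :: complex and a
    using real_sqrt_le_iff[of a "(norm y)\<^sup>2"] real_sqrt_le_iff[of "(norm y)\<^sup>2" a]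
      real_sqrt_less_iff[of a "(norm y)\<^sup>2"] real_sqrt_less_iff[of "(norm y)\<^sup>2" a] by simp_all
  have cat: "norm (y, of_real l / y) \<le> 1 \<longleftrightarrow> r1 \<le> norm y \<and> norm y \<le> r2"
    "norm (y, of_real l / y) < 1 \<longleftrightarrow> r1 < norm y \<and> norm y < r2" if "y \<noteq> 0" for y :: complex
  proof -
    have "norm (y, of_real l / y) = sqrt ((norm y)\<^sup>2 + (norm (of_real (- \<gamma> / 2) / y))\<^sup>2)"
      by (simp only: norm_prod_def l_def fst_conv snd_conv)
    then show "norm (y, of_real l / y) \<le> 1 \<longleftrightarrow> r1 \<le> norm y \<and> norm y \<le> r2"
      "norm (y, of_real l / y) < 1 \<longleftrightarrow> r1 < norm y \<and> norm y < r2"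
      using catenoid_norm[OF that \<sigma>]
      by (simp_all only: r1_def r2_def sq real_sqrt_le_1_iff real_sqrt_lt_1_iff)
  qed
  have Xn: "norm (z p, of_real l / z p) = norm (X p)" if "p \<in> strip" for p
    using adapted_norm[OF e, of "X p"] by (simp only: ad w_eq[OF that])
  have im_le: "r1 \<le> norm (z p) \<and> norm (z p) \<le> r2" if "p \<in> strip" for p
    using cat(1)[OF zne[OF that]] Xn[OF that] ball[OF that] by simp
  \<comment> \<open>\<open>norm (X p) = 1\<close> on the sides, so the two radius bounds cannot both
    be strict.\<close>
  have im_bd: "norm (z p) = r1 \<or> norm (z p) = r2" if "p \<in> strip_boundary" for p
    using cat(2)[OF zne[OF bdst[OF that]]] im_le[OF bdst[OF that]] Xn[OF bdst[OF that]] sph[OF that] by auto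
  have r1: "0 < r1"
  proof -
    have "\<sigma> \<noteq> 1" using \<sigma>(2) \<open>\<gamma> \<noteq> 0\<close> by auto
    then show ?thesis using \<sigma>le by (simp add: r1_def)
  qed
  have image: "r1 < r2" "z ` strip = {y. r1 \<le> norm y \<and> norm y \<le> r2}"
    using catenoid_image[OF \<mu> z z1ne perz less_imp_le[OF r1] im_bd im_le] by blast+
  \<comment> \<open>The strict bound on \<open>l\<close> comes from \<open>r1 < r2\<close>: the
    image is a genuine annulus.\<close>
  have "\<sigma> > 0" using image(1) by (simp add: r1_def r2_def)
  then have "\<sigma>\<^sup>2 > 0" by simp
  then have "\<gamma>\<^sup>2 < 1" using \<sigma>(2) by linarith
  then have l2: "\<bar>l\<bar> < 1 / 2" by (simp add: l_def abs_square_less_1)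
  have "(\<lambda>p. adapted e \<alpha> \<beta> (X p)) ` strip = (\<lambda>y. (y, of_real l / y)) ` z ` strip"
    unfolding image_image by (rule image_cong) (auto simp: ad w_eq)
  also have "\<dots> = lagrangian_catenoid l \<inter> cball 0 1"
  proof -
    have *: "(r1 \<le> norm y \<and> norm y \<le> r2) = (y \<noteq> 0 \<and> (y, of_real l / y) \<in> cball 0 1)" for y :: complex
      unfolding mem_cball_0 using r1 cat(1)[of y] by (cases "y = 0") simp_all
    have "z ` strip = {y. y \<noteq> 0 \<and> (y, of_real l / y) \<in> cball 0 1}"
      unfolding image(2) by (rule Collect_cong[OF *])
    then show ?thesis unfolding lagrangian_catenoid_def by blast
  qed
  finally show thesis using that[OF e _ l2] l0 by simp
qed

theorem theorem3p3:
  fixes A :: "'a set" and \<phi> :: "real \<times> complex \<Rightarrow> 'a" and x :: "'a \<Rightarrow> complex \<times> complex"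
  assumes "compact_annulus \<phi> A"
    and "x ` A \<subseteq> cball 0 1"
    and "immersion (in_coords \<phi> x)"
    and "minimal (in_coords \<phi> x)"
    and "lagrangian (in_coords \<phi> x)"
    and "legendrian_capillary_boundary (in_coords \<phi> x)"
  shows "\<exists>(l::real) P. 0 < \<bar>l\<bar> \<and> \<bar>l\<bar> < 1 / 2 \<and> rigid_motion P \<and>
           x ` A = P ` (lagrangian_catenoid l \<inter> cball 0 1)"
proof -
  define X where "X = in_coords \<phi> x"
  have XA: "X ` strip = x ` A" unfolding X_def by (rule in_coords_image[OF assms(1)])
  have "norm (X p) \<le> 1" if "p \<in> strip" for p
    using that XA assms(2) by (metis image_eqI subsetD mem_cball_0)
  then obtain e \<alpha> \<beta> l where e: "norm e = 1" "(norm \<alpha>)\<^sup>2 + (norm \<beta>)\<^sup>2 = 1" and l: "0 < \<bar>l\<bar>" "\<bar>l\<bar> < 1 / 2"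
    and im: "(\<lambda>p. adapted e \<alpha> \<beta> (X p)) ` strip = lagrangian_catenoid l \<inter> cball 0 1"
    using capillary_minimal_lagrangian_image[OF assms(3-6)] in_coords_periodic[of \<phi> x]
    unfolding X_def by metis
  define Q where "Q = adapted e \<alpha> \<beta>"
  interpret Q: bounded_linear Q unfolding Q_def by (rule bounded_linear_adapted)
  have dQ: "dist (Q u) (Q v) = dist u v" for u v
    unfolding dist_norm Q.diff[symmetric] unfolding Q_def by (rule adapted_norm[OF e])
  have injQ: "inj Q" by (rule injI) (metis dQ dist_eq_0_iff)
  have surjQ: "surj Q" by (rule linear_injective_imp_surjective[OF Q.linear injQ refl])
  \<comment> \<open>\<open>Q\<close> carries the surface onto the catenoid, so the required motion
    is its inverse.\<close>
  have "rigid_motion (inv Q)"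
    unfolding rigid_motion_def using dQ surj_f_inv_f[OF surjQ] inj_imp_surj_inv[OF injQ] by metis
  moreover have "x ` A = inv Q ` (lagrangian_catenoid l \<inter> cball 0 1)"
    unfolding im[symmetric] XA[symmetric] Q_def[symmetric] image_image using injQ by simp
  ultimately show ?thesis using l by blast
qed

end
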